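(* Let $\lambda_1,\lambda_2,\lambda_3,\lambda_4\in\mathbb R$, and let $G$ be a connected 4-dimensional Lie group whose Lie algebra has a basis of left-invariant vector fields $\{X_1,X_2,X_3,X_4\}$ with $$\begin{array}{ll}[X_1,X_3]=\lambda_2X_2+\lambda_4X_4,&[X_2,X_4]=\lambda_1X_1+\lambda_3X_3,\\ {}[X_2,X_3]=-\lambda_2X_1-\lambda_3X_4,&[X_3,X_4]=-\lambda_4X_1+\lambda_3X_2,\\ {}[X_4,X_1]=\lambda_1X_2+\lambda_4X_3,&[X_2,X_1]=-\lambda_2X_3+\lambda_1X_4.\end{array}$$ Let $J$ be the left-invariant almost complex structure with $JX_1=X_3$, $JX_2=X_4$, $JX_3=-X_1$, $JX_4=-X_2$, let $g$ be the left-invariant metric with $g(X_1,X_1)=g(X_2,X_2)=-g(X_3,X_3)=-g(X_4,X_4)=1$ and $g(X_i,X_j)=0$ for $i\ne j$, and let $\tilde g(X,Y)=g(X,JY)$. Then $(G,J,\tilde g)$ is an isotropic Kähler manifold with Norden metric if and only if its scalar curvature $\tilde\tau$ is zero.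
   Context: A Norden metric on an almost complex manifold $(M,J)$ (with $J^2=-\mathrm{id}$) is a pseudo-Riemannian metric $h$ such that $h(JX,JY)=-h(X,Y)$ for all vector fields $X,Y$; $g$ and $\tilde g$ are both Norden metrics on $(G,J)$. Let $\tilde\nabla$ be the Levi-Civita connection of $\tilde g$, and let $\tilde g^{ij}$ be the entries of the inverse of the matrix $(\tilde g(e_i,e_j))$ in a basis $\{e_i\}$ of a tangent space. The square norm of $\tilde\nabla J$ with respect to $\tilde g$ is $$\|\tilde\nabla J\|^2=\tilde g^{ij}\tilde g^{kl}\,\tilde g\bigl((\tilde\nabla_{e_i}J)e_k,(\tilde\nabla_{e_j}J)e_l\bigr)$$ (summation over repeated indices). The manifold $(G,J,\tilde g)$ is called an isotropic Kähler manifold with Norden metric if $\|\tilde\nabla J\|^2=0$. Curvature conventions: $\tilde R(X,Y)Z=\tilde\nabla_X\tilde\nabla_YZ-\tilde\nabla_Y\tilde\nabla_XZ-\tilde\nabla_{[X,Y]}Z$, $\tilde R(X,Y,Z,U)=\tilde g(\tilde R(X,Y)Z,U)$, $\tilde\rho(y,z)=\tilde g^{ij}\tilde R(e_i,y,z,e_j)$, $\tilde\tau=\tilde g^{ij}\tilde\rho(e_i,e_j)$. *)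

theory Defs
  imports "HOL-Analysis.Analysis" "HOL-Library.Function_Algebras"
begin

instantiation "fun" :: (type, real_vector) real_vector
begin

definition scaleR_fun :: "real \<Rightarrow> ('a \<Rightarrow> 'b) \<Rightarrow> 'a \<Rightarrow> 'b"
  where "scaleR_fun c f = (\<lambda>x. c *\<^sub>R f x)"

instance
  by standard (auto simp: scaleR_fun_def fun_eq_iff scaleR_add_right scaleR_add_left)

end

definition basis_family :: "'v::real_vector set \<Rightarrow> ('n \<Rightarrow> 'v) \<Rightarrow> bool" where
  "basis_family V e \<longleftrightarrow> inj e \<and> independent (range e) \<and> span (range e) = V"


section \<open>Smooth manifolds\<close>

text \<open>These two notions are meant for open \<open>S\<close> only.\<close>

primrec C_k_on :: "nat \<Rightarrow> 'e::euclidean_space set \<Rightarrow> ('e \<Rightarrow> 'f::euclidean_space) \<Rightarrow> bool" where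
  "C_k_on 0 S f \<longleftrightarrow> continuous_on S f"
| "C_k_on (Suc k) S f \<longleftrightarrow>
     (\<forall>x\<in>S. f differentiable (at x)) \<and> (\<forall>v. C_k_on k S (\<lambda>x. frechet_derivative f (at x) v))"

definition smooth_on :: "'e::euclidean_space set \<Rightarrow> ('e \<Rightarrow> 'f::euclidean_space) \<Rightarrow> bool" where
  "smooth_on S f \<longleftrightarrow> (\<forall>k. C_k_on k S f)"

text \<open>A chart \<open>(U, \<phi>)\<close> consists of its domain and its coordinate map; \<open>inv_into U \<phi>\<close> is the
  inverse of \<open>\<phi>\<close> on \<open>\<phi> ` U\<close>. The manifold is the whole type \<open>'a\<close>, and its dimension is \<open>DIM('e)\<close>.
  The smooth structure is given by an atlas that need not be maximal.\<close>

type_synonym ('a, 'e) chart = "'a set \<times> ('a \<Rightarrow> 'e)"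

definition smooth_atlas ::
    "('a::{t2_space, second_countable_topology}, 'e::euclidean_space) chart set \<Rightarrow> bool" where
  "smooth_atlas A \<longleftrightarrow>
     (\<Union>(U, \<phi>)\<in>A. U) = UNIV \<and>
     (\<forall>(U, \<phi>)\<in>A. open U \<and> open (\<phi> ` U) \<and> homeomorphism U (\<phi> ` U) \<phi> (inv_into U \<phi>)) \<and>
     (\<forall>(U, \<phi>)\<in>A. \<forall>(V, \<psi>)\<in>A. smooth_on (\<phi> ` (U \<inter> V)) (\<psi> \<circ> inv_into U \<phi>))"

definition smooth_map ::
    "('a::topological_space, 'e::euclidean_space) chart set \<Rightarrow>
     ('b::topological_space, 'f::euclidean_space) chart set \<Rightarrow> ('a \<Rightarrow> 'b) \<Rightarrow> bool" where
  "smooth_map A B F \<longleftrightarrow>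
     continuous_on UNIV F \<and>
     (\<forall>(U, \<phi>)\<in>A. \<forall>(V, \<psi>)\<in>B. smooth_on (\<phi> ` (U \<inter> F -` V)) (\<psi> \<circ> F \<circ> inv_into U \<phi>))"

definition smooth_fun ::
    "('a::topological_space, 'e::euclidean_space) chart set \<Rightarrow> ('a \<Rightarrow> real) \<Rightarrow> bool" where
  "smooth_fun A f \<longleftrightarrow> smooth_map A {(UNIV, id)} f"

definition prod_atlas ::
    "('a, 'e) chart set \<Rightarrow> ('b, 'f) chart set \<Rightarrow> ('a \<times> 'b, 'e \<times> 'f) chart set" where
  "prod_atlas A B = {(U \<times> V, map_prod \<phi> \<psi>) | U \<phi> V \<psi>. (U, \<phi>) \<in> A \<and> (V, \<psi>) \<in> B}"


section \<open>Tangent vectors and vector fields\<close>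

text \<open>A tangent vector at \<open>p\<close> is the operation on smooth functions of differentiating at \<open>p\<close> in some
  coordinate direction \<open>u\<close>, that is, a linear combination of the coordinate derivations at \<open>p\<close>.
  It is set to 0 on functions that are not smooth, so that two tangent vectors are equal as soon as
  they agree on the smooth functions.\<close>

type_synonym 'a tangent = "('a \<Rightarrow> real) \<Rightarrow> real"

type_synonym 'a field = "'a \<Rightarrow> 'a tangent"

definition coord_derivative ::
    "('a::topological_space, 'e::euclidean_space) chart set \<Rightarrow> ('a, 'e) chart \<Rightarrow> 'a \<Rightarrow> 'e \<Rightarrow> 'a tangent"
  where
  "coord_derivative A c p u =
     (\<lambda>f. if smooth_fun A f
          then frechet_derivative (f \<circ> inv_into (fst c) (snd c)) (at (snd c p)) u else 0)"

definition tangent_space ::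
    "('a::topological_space, 'e::euclidean_space) chart set \<Rightarrow> 'a \<Rightarrow> 'a tangent set" where
  "tangent_space A p = {coord_derivative A c p u | c u. c \<in> A \<and> p \<in> fst c}"

definition push_forward ::
    "('b::topological_space, 'f::euclidean_space) chart set \<Rightarrow> ('a \<Rightarrow> 'b) \<Rightarrow> 'a tangent \<Rightarrow> 'b tangent"
  where "push_forward B F v = (\<lambda>f. if smooth_fun B f then v (f \<circ> F) else 0)"

definition smooth_field ::
    "('a::topological_space, 'e::euclidean_space) chart set \<Rightarrow> 'a field \<Rightarrow> bool" where
  "smooth_field A X \<longleftrightarrow>
     (\<forall>p. X p \<in> tangent_space A p) \<and> (\<forall>f. smooth_fun A f \<longrightarrow> smooth_fun A (\<lambda>p. X p f))"

definition fun_scale :: "('a \<Rightarrow> real) \<Rightarrow> 'a field \<Rightarrow> 'a field" where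
  "fun_scale f X = (\<lambda>p. f p *\<^sub>R X p)"

definition lie_bracket :: "'a field \<Rightarrow> 'a field \<Rightarrow> 'a field" where
  "lie_bracket X Y = (\<lambda>p f. X p (\<lambda>q. Y q f) - Y p (\<lambda>q. X q f))"


section \<open>Metrics, almost complex structures, connections\<close>

type_synonym 'a metric = "'a \<Rightarrow> 'a tangent \<Rightarrow> 'a tangent \<Rightarrow> real"

type_synonym 'a endo = "'a \<Rightarrow> 'a tangent \<Rightarrow> 'a tangent"

type_synonym 'a connection = "'a field \<Rightarrow> 'a field \<Rightarrow> 'a field"

text \<open>Tensors are only constrained on tangent vectors, connections only on smooth vector fields;
  their values on other arguments are irrelevant.\<close>

definition pseudo_riemannian ::
    "('a::topological_space, 'e::euclidean_space) chart set \<Rightarrow> 'a metric \<Rightarrow> bool" where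
  "pseudo_riemannian A h \<longleftrightarrow>
     (\<forall>p. \<forall>u\<in>tangent_space A p. \<forall>v\<in>tangent_space A p.
        h p u v = h p v u \<and>
        (\<forall>w\<in>tangent_space A p. \<forall>a b. h p (a *\<^sub>R u + b *\<^sub>R v) w = a * h p u w + b * h p v w)) \<and>
     (\<forall>p. \<forall>u\<in>tangent_space A p. (\<forall>v\<in>tangent_space A p. h p u v = 0) \<longrightarrow> u = 0) \<and>
     (\<forall>X Y. smooth_field A X \<longrightarrow> smooth_field A Y \<longrightarrow> smooth_fun A (\<lambda>p. h p (X p) (Y p)))"

definition apply_endo :: "'a endo \<Rightarrow> 'a field \<Rightarrow> 'a field" where
  "apply_endo J X = (\<lambda>p. J p (X p))"

definition almost_complex ::
    "('a::topological_space, 'e::euclidean_space) chart set \<Rightarrow> 'a endo \<Rightarrow> bool" where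
  "almost_complex A J \<longleftrightarrow>
     (\<forall>p. \<forall>u\<in>tangent_space A p. J p u \<in> tangent_space A p \<and> J p (J p u) = - u \<and>
        (\<forall>v\<in>tangent_space A p. \<forall>a b. J p (a *\<^sub>R u + b *\<^sub>R v) = a *\<^sub>R J p u + b *\<^sub>R J p v)) \<and>
     (\<forall>X. smooth_field A X \<longrightarrow> smooth_field A (apply_endo J X))"

definition norden_metric ::
    "('a::topological_space, 'e::euclidean_space) chart set \<Rightarrow> 'a endo \<Rightarrow> 'a metric \<Rightarrow> bool" where
  "norden_metric A J h \<longleftrightarrow>
     almost_complex A J \<and> pseudo_riemannian A h \<and>
     (\<forall>p. \<forall>u\<in>tangent_space A p. \<forall>v\<in>tangent_space A p. h p (J p u) (J p v) = - h p u v)"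

definition affine_connection ::
    "('a::topological_space, 'e::euclidean_space) chart set \<Rightarrow> 'a connection \<Rightarrow> bool" where
  "affine_connection A D \<longleftrightarrow>
     (\<forall>X Y. smooth_field A X \<longrightarrow> smooth_field A Y \<longrightarrow>
        smooth_field A (D X Y) \<and>
        (\<forall>Z. smooth_field A Z \<longrightarrow>
           D (X + Y) Z = D X Z + D Y Z \<and> D Z (X + Y) = D Z X + D Z Y) \<and>
        (\<forall>f. smooth_fun A f \<longrightarrow>
           D (fun_scale f X) Y = fun_scale f (D X Y) \<and>
           D X (fun_scale f Y) = fun_scale (\<lambda>p. X p f) Y + fun_scale f (D X Y)))"

definition levi_civita ::
    "('a::topological_space, 'e::euclidean_space) chart set \<Rightarrow> 'a metric \<Rightarrow> 'a connection \<Rightarrow> bool" where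
  "levi_civita A h D \<longleftrightarrow>
     affine_connection A D \<and>
     (\<forall>X Y. smooth_field A X \<longrightarrow> smooth_field A Y \<longrightarrow> D X Y - D Y X = lie_bracket X Y) \<and>
     (\<forall>X Y Z. smooth_field A X \<longrightarrow> smooth_field A Y \<longrightarrow> smooth_field A Z \<longrightarrow>
        (\<forall>p. X p (\<lambda>q. h q (Y q) (Z q)) = h p (D X Y p) (Z p) + h p (Y p) (D X Z p)))"

definition deriv_endo :: "'a connection \<Rightarrow> 'a endo \<Rightarrow> 'a field \<Rightarrow> 'a field \<Rightarrow> 'a field" where
  "deriv_endo D J X Y = D X (apply_endo J Y) - apply_endo J (D X Y)"

definition curvature :: "'a connection \<Rightarrow> 'a field \<Rightarrow> 'a field \<Rightarrow> 'a field \<Rightarrow> 'a field" where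
  "curvature D X Y Z = D X (D Y Z) - D Y (D X Z) - D (lie_bracket X Y) Z"

definition curvature4 ::
    "'a metric \<Rightarrow> 'a connection \<Rightarrow> 'a field \<Rightarrow> 'a field \<Rightarrow> 'a field \<Rightarrow> 'a field \<Rightarrow> 'a \<Rightarrow> real" where
  "curvature4 h D X Y Z U p = h p (curvature D X Y Z p) (U p)"


section \<open>Contractions\<close>

text \<open>A basis \<open>e\<^sub>i\<close> of the tangent space at \<open>p\<close> is given by smooth vector fields \<open>E i\<close> with
  \<open>E i p = e\<^sub>i\<close>, so that tensors defined through vector fields can be evaluated on it. The
  contractions below are the values common to all such choices; these agree because the contracted
  expressions are tensorial.\<close>

definition basis_fields_at ::
    "('a::topological_space, real ^ 'n) chart set \<Rightarrow> 'a \<Rightarrow> ('n \<Rightarrow> 'a field) \<Rightarrow> bool" where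
  "basis_fields_at A p E \<longleftrightarrow>
     (\<forall>i. smooth_field A (E i)) \<and> basis_family (tangent_space A p) (\<lambda>i. E i p)"

definition inverse_metric :: "'a metric \<Rightarrow> 'a \<Rightarrow> ('n::finite \<Rightarrow> 'a field) \<Rightarrow> 'n \<Rightarrow> 'n \<Rightarrow> real" where
  "inverse_metric h p E i j = matrix_inv (\<chi> k l. h p (E k p) (E l p)) $ i $ j"

definition ricci ::
    "('a::topological_space, real ^ 'n::finite) chart set \<Rightarrow> 'a metric \<Rightarrow> 'a connection \<Rightarrow>
     'a field \<Rightarrow> 'a field \<Rightarrow> 'a \<Rightarrow> real" where
  "ricci A h D Y Z p = (THE r. \<forall>E. basis_fields_at A p E \<longrightarrow>
     r = (\<Sum>i\<in>UNIV. \<Sum>j\<in>UNIV. inverse_metric h p E i j * curvature4 h D (E i) Y Z (E j) p))"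

definition scalar_curvature ::
    "('a::topological_space, real ^ 'n::finite) chart set \<Rightarrow> 'a metric \<Rightarrow> 'a connection \<Rightarrow> 'a \<Rightarrow> real"
  where
  "scalar_curvature A h D p = (THE r. \<forall>E. basis_fields_at A p E \<longrightarrow>
     r = (\<Sum>i\<in>UNIV. \<Sum>j\<in>UNIV. inverse_metric h p E i j * ricci A h D (E i) (E j) p))"

definition square_norm_deriv ::
    "('a::topological_space, real ^ 'n::finite) chart set \<Rightarrow> 'a endo \<Rightarrow> 'a metric \<Rightarrow> 'a connection \<Rightarrow>
     'a \<Rightarrow> real" where
  "square_norm_deriv A J h D p = (THE r. \<forall>E. basis_fields_at A p E \<longrightarrow>
     r = (\<Sum>i\<in>UNIV. \<Sum>j\<in>UNIV. \<Sum>k\<in>UNIV. \<Sum>l\<in>UNIV.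
            inverse_metric h p E i j * inverse_metric h p E k l *
            h p (deriv_endo D J (E i) (E k) p) (deriv_endo D J (E j) (E l) p)))"

text \<open>Here \<open>D\<close> stands for the Levi-Civita connection of \<open>h\<close>.\<close>

definition isotropic_kaehler_norden ::
    "('a::topological_space, real ^ 'n::finite) chart set \<Rightarrow> 'a endo \<Rightarrow> 'a metric \<Rightarrow> 'a connection \<Rightarrow>
     bool" where
  "isotropic_kaehler_norden A J h D \<longleftrightarrow>
     norden_metric A J h \<and> levi_civita A h D \<and> (\<forall>p. square_norm_deriv A J h D p = 0)"


section \<open>Lie groups\<close>

definition lie_group ::
    "('a::{t2_space, second_countable_topology}, 'e::euclidean_space) chart set \<Rightarrow>
     ('a \<Rightarrow> 'a \<Rightarrow> 'a) \<Rightarrow> 'a \<Rightarrow> ('a \<Rightarrow> 'a) \<Rightarrow> bool" where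
  "lie_group A mul e invr \<longleftrightarrow>
     smooth_atlas A \<and> group mul e invr \<and>
     smooth_map (prod_atlas A A) A (\<lambda>(x, y). mul x y) \<and> smooth_map A A invr"

definition left_invariant_field ::
    "('a::topological_space, 'e::euclidean_space) chart set \<Rightarrow> ('a \<Rightarrow> 'a \<Rightarrow> 'a) \<Rightarrow> 'a field \<Rightarrow> bool" where
  "left_invariant_field A mul X \<longleftrightarrow> (\<forall>a p. X (mul a p) = push_forward A (mul a) (X p))"

definition lie_algebra ::
    "('a::topological_space, 'e::euclidean_space) chart set \<Rightarrow> ('a \<Rightarrow> 'a \<Rightarrow> 'a) \<Rightarrow> 'a field set" where
  "lie_algebra A mul = {X. smooth_field A X \<and> left_invariant_field A mul X}"

definition left_invariant_metric ::
    "('a::topological_space, 'e::euclidean_space) chart set \<Rightarrow> ('a \<Rightarrow> 'a \<Rightarrow> 'a) \<Rightarrow> 'a metric \<Rightarrow> bool" where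
  "left_invariant_metric A mul h \<longleftrightarrow>
     (\<forall>a p. \<forall>u\<in>tangent_space A p. \<forall>v\<in>tangent_space A p.
        h (mul a p) (push_forward A (mul a) u) (push_forward A (mul a) v) = h p u v)"

definition left_invariant_endo ::
    "('a::topological_space, 'e::euclidean_space) chart set \<Rightarrow> ('a \<Rightarrow> 'a \<Rightarrow> 'a) \<Rightarrow> 'a endo \<Rightarrow> bool" where
  "left_invariant_endo A mul J \<longleftrightarrow>
     (\<forall>a p. \<forall>u\<in>tangent_space A p.
        J (mul a p) (push_forward A (mul a) u) = push_forward A (mul a) (J p u))"

end

theory Submission
  imports Defs
begin

text \<open>The coefficients of a smooth field with respect to the frame \<open>X 1, \<dots>, X 4\<close> are, up to sign, its
  \<open>g\<close>-products with the frame, hence smooth. So every contraction, being tensorial, may be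
  evaluated on this global frame. There the products of frame fields with respect to the twin metric
  are constant, the Koszul formula determines the Levi-Civita connection, and the two scalars come
  out as \<open>- 8 (l1 l3 + l2 l4)\<close> and \<open>- 5 (l1 l3 + l2 l4)\<close>, which vanish simultaneously.\<close>

text \<open>The contracted quantities are definite descriptions over all families of smooth fields
  that form a basis at the single point \<open>p\<close>, so no value is available before
  independence of the family is known. Pointwise dependence of a tensor is usually obtained by
  localising with bump functions. Here each competing family is expanded in the frame with
  coefficients smooth on the whole manifold, so linearity over global smooth functions suffices. Two
  metrics share one frame. It is diagonal for \<open>g\<close>, which makes coefficients easy to
  isolate, while the connection belongs to the twin metric. What is gained from \<open>g\<close>, a
  basis at every point and smooth coefficients, mentions no metric and therefore transfers. The
  final calculation stays within fields with constant coefficients, a class preserved by the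
  bracket, the connection and \<open>J\<close>.\<close>

lemma scaleR_fun_apply [simp]: "(c *\<^sub>R f) x = c *\<^sub>R f x"
  by (simp add: scaleR_fun_def)

section \<open>The algebra of smooth functions\<close>

text \<open>Derivative rules describe \<open>frechet_derivative\<close> only at points of
  \<open>S\<close>. Openness of \<open>S\<close> makes the derivatives of functions agreeing on
  \<open>S\<close> agree there too, so the congruence passes through every order.\<close>

lemma C_k_on_cong:
  assumes "open S" "\<And>x. x \<in> S \<Longrightarrow> f x = g x" "C_k_on k S f"
  shows "C_k_on k S g"
  using assms(2,3)
proof (induction k arbitrary: f g)
  case 0
  then show ?case by (auto cong: continuous_on_cong)
next
  case (Suc k)
  have diff: "f differentiable (at x)" if "x \<in> S" for x
    using Suc.prems that by auto
  have "frechet_derivative f (at x) = frechet_derivative g (at x)" if "x \<in> S" for x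
    using frechet_derivative_transform_within_open[OF diff \<open>open S\<close>] that Suc.prems(1) by blast
  then have "C_k_on k S (\<lambda>x. frechet_derivative g (at x) v)" for v
    using Suc.IH[of "\<lambda>x. frechet_derivative f (at x) v" "\<lambda>x. frechet_derivative g (at x) v"]
      Suc.prems(2) by auto
  moreover have "g differentiable (at x)" if "x \<in> S" for x
    using has_derivative_transform_within_open[OF _ \<open>open S\<close> that, of f _ UNIV g] diff[OF that]
      Suc.prems(1) unfolding differentiable_def by blast
  ultimately show ?case by auto
qed

lemma C_k_on_Suc_imp: "C_k_on (Suc k) S f \<Longrightarrow> C_k_on k S f"
proof (induction k arbitrary: f)
  case 0
  then show ?case
    by (auto intro!: continuous_at_imp_continuous_on differentiable_imp_continuous_within)
next
  case (Suc k)
  then show ?case by (metis C_k_on.simps(2))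
qed

lemma C_k_on_const: "C_k_on k S (\<lambda>x. c)"
  by (induction k arbitrary: c) auto

lemma C_k_on_add:
  assumes "open S"
  shows "C_k_on k S f \<Longrightarrow> C_k_on k S g \<Longrightarrow> C_k_on k S (\<lambda>x. f x + g x)"
proof (induction k arbitrary: f g)
  case 0
  then show ?case by (simp add: continuous_on_add continuous_on_mult)
next
  case (Suc k)
  have "frechet_derivative (\<lambda>x. f x + g x) (at x) v =
      frechet_derivative f (at x) v + frechet_derivative g (at x) v" if "x \<in> S" for x v
  proof -
    have "(f has_derivative frechet_derivative f (at x)) (at x)"
      "(g has_derivative frechet_derivative g (at x)) (at x)"
      using Suc.prems that by (simp_all flip: frechet_derivative_works)
    from fun_cong[OF frechet_derivative_at[OF has_derivative_add[OF this]], of v] show ?thesis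
      by simp
  qed
  then have "C_k_on k S (\<lambda>x. frechet_derivative (\<lambda>x. f x + g x) (at x) v)" for v
    using Suc.prems
    by - (rule C_k_on_cong[OF assms _ Suc.IH[of "\<lambda>x. frechet_derivative f (at x) v"
        "\<lambda>x. frechet_derivative g (at x) v"]], simp_all)
  then show ?case using Suc.prems by simp
qed

lemma C_k_on_mult:
  fixes f g :: "'e::euclidean_space \<Rightarrow> real"
  assumes "open S"
  shows "C_k_on k S f \<Longrightarrow> C_k_on k S g \<Longrightarrow> C_k_on k S (\<lambda>x. f x * g x)"
proof (induction k arbitrary: f g)
  case 0
  then show ?case by (simp add: continuous_on_add continuous_on_mult)
next
  case (Suc k)
  have "frechet_derivative (\<lambda>x. f x * g x) (at x) v =
      f x * frechet_derivative g (at x) v + frechet_derivative f (at x) v * g x" if "x \<in> S" for x v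
  proof -
    have "(f has_derivative frechet_derivative f (at x)) (at x)"
      "(g has_derivative frechet_derivative g (at x)) (at x)"
      using Suc.prems that by (simp_all flip: frechet_derivative_works)
    from fun_cong[OF frechet_derivative_at[OF has_derivative_mult[OF this]], of v] show ?thesis
      by simp
  qed
  \<comment> \<open>Each summand contains an undifferentiated factor, whose order has to be lowered
    from \<open>Suc k\<close> to \<open>k\<close> before the induction hypothesis applies.\<close>
  moreover have "C_k_on k S (\<lambda>x. f x * frechet_derivative g (at x) v + frechet_derivative f (at x) v * g x)" for v
    using Suc.prems C_k_on_Suc_imp[OF Suc.prems(1)] C_k_on_Suc_imp[OF Suc.prems(2)]
    by (intro C_k_on_add[OF assms] Suc.IH) auto
  ultimately have "C_k_on k S (\<lambda>x. frechet_derivative (\<lambda>x. f x * g x) (at x) v)" for v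
    by - (rule C_k_on_cong[OF assms], auto)
  then show ?case using Suc.prems by (auto intro: differentiable_mult)
qed

lemma smooth_fun_iff:
  "smooth_fun A f \<longleftrightarrow> continuous_on UNIV f \<and>
     (\<forall>(U, \<phi>)\<in>A. smooth_on (\<phi> ` U) (\<lambda>x. f (inv_into U \<phi> x)))"
  by (simp add: smooth_fun_def smooth_map_def o_def)

locale manifold =
  fixes A :: "('a::{t2_space, second_countable_topology}, 'e::euclidean_space) chart set"
  assumes atlas: "smooth_atlas A"
begin

lemma chart_open: "(U, \<phi>) \<in> A \<Longrightarrow> open U" "(U, \<phi>) \<in> A \<Longrightarrow> open (\<phi> ` U)"
  using atlas unfolding smooth_atlas_def by auto

lemma chart_homeomorphism: "(U, \<phi>) \<in> A \<Longrightarrow> homeomorphism U (\<phi> ` U) \<phi> (inv_into U \<phi>)"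
  using atlas unfolding smooth_atlas_def by auto

lemma chart_inj: "(U, \<phi>) \<in> A \<Longrightarrow> inj_on \<phi> U"
  by (rule inj_on_inverseI, rule homeomorphism_apply1[OF chart_homeomorphism])

lemma smooth_fun_const [simp]: "smooth_fun A (\<lambda>x. c)"
  by (auto simp: smooth_fun_iff smooth_on_def C_k_on_const)

lemma smooth_fun_add: "smooth_fun A f \<Longrightarrow> smooth_fun A g \<Longrightarrow> smooth_fun A (\<lambda>x. f x + g x)"
  unfolding smooth_fun_iff smooth_on_def
  by (auto intro!: continuous_on_add C_k_on_add dest: chart_open(2) split: prod.splits)

lemma smooth_fun_mult: "smooth_fun A f \<Longrightarrow> smooth_fun A g \<Longrightarrow> smooth_fun A (\<lambda>x. f x * g x)"
  unfolding smooth_fun_iff smooth_on_def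
  by (auto intro!: continuous_on_mult C_k_on_mult dest: chart_open(2) split: prod.splits)

section \<open>Tangent spaces\<close>

lemma smooth_fun_differentiable:
  assumes "smooth_fun A f" "(U, \<phi>) \<in> A" "p \<in> U"
  shows "(f \<circ> inv_into U \<phi>) differentiable (at (\<phi> p))"
proof -
  have "C_k_on (Suc 0) (\<phi> ` U) (f \<circ> inv_into U \<phi>)"
    using assms unfolding smooth_fun_iff smooth_on_def o_def by blast
  then show ?thesis using assms(3) by auto
qed

lemma linear_coord_derivative:
  assumes "(U, \<phi>) \<in> A" "p \<in> U"
  shows "linear (coord_derivative A (U, \<phi>) p)"
proof -
  have lin: "linear (frechet_derivative (f \<circ> inv_into U \<phi>) (at (\<phi> p)))" if "smooth_fun A f" for f
    by (rule linear_frechet_derivative[OF smooth_fun_differentiable[OF that assms]])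
  show ?thesis
    by (rule linearI)
      (auto simp: coord_derivative_def fun_eq_iff linear_add[OF lin] linear_scale[OF lin])
qed

text \<open>Chain rule through the transition map: its derivative turns a direction in one chart
  into a direction in the other.\<close>

lemma coord_derivative_change:
  assumes c: "(U, \<phi>) \<in> A" "p \<in> U" and d: "(V, \<psi>) \<in> A" "p \<in> V"
  shows "coord_derivative A (V, \<psi>) p u =
    coord_derivative A (U, \<phi>) p (frechet_derivative (\<phi> \<circ> inv_into V \<psi>) (at (\<psi> p)) u)"
proof
  fix f
  let ?S = "\<psi> ` (V \<inter> U)" and ?t = "\<phi> \<circ> inv_into V \<psi>"
  have inj: "inj_on \<psi> V" "inj_on \<phi> U"
    using chart_inj c(1) d(1) by blast+
  show "coord_derivative A (V, \<psi>) p u f =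
    coord_derivative A (U, \<phi>) p (frechet_derivative ?t (at (\<psi> p)) u) f"
  proof (cases "smooth_fun A f")
    case True
    have "smooth_on ?S ?t"
      using atlas c(1) d(1) unfolding smooth_atlas_def by fast
    then have "C_k_on (Suc 0) ?S ?t"
      unfolding smooth_on_def by (rule spec)
    then have dt: "?t differentiable (at (\<psi> p))"
      using c(2) d(2) by simp
    have tp: "?t (\<psi> p) = \<phi> p"
      using inj d by simp
    \<comment> \<open>\<open>(f \<circ> inv_into U \<phi>) \<circ> ?t\<close> and
      \<open>f \<circ> inv_into V \<psi>\<close> are known to agree only over the overlap, so its
      image must be open for the derivative to carry over.\<close>
    have "open ?S"
    proof -
      have "openin (top_of_set (\<psi> ` V)) ?S"
        using homeomorphism_imp_open_map[OF chart_homeomorphism[OF d(1)], of "V \<inter> U"]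
          chart_open(1)[OF c(1)] by (simp add: openin_open_Int)
      then show ?thesis
        using chart_open(2)[OF d(1)] by (simp add: openin_open_eq)
    qed
    have "((f \<circ> inv_into U \<phi>) \<circ> ?t has_derivative
        frechet_derivative (f \<circ> inv_into U \<phi>) (at (\<phi> p)) \<circ> frechet_derivative ?t (at (\<psi> p)))
        (at (\<psi> p))"
      using diff_chain_at dt smooth_fun_differentiable[OF True c] tp
      unfolding frechet_derivative_works by metis
    then have "((f \<circ> inv_into V \<psi>) has_derivative
        frechet_derivative (f \<circ> inv_into U \<phi>) (at (\<phi> p)) \<circ> frechet_derivative ?t (at (\<psi> p)))
        (at (\<psi> p))"
      by (rule has_derivative_transform_within_open[OF _ \<open>open ?S\<close>]) (use c d inj in auto)
    from fun_cong[OF frechet_derivative_at[OF this], of u] show ?thesis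
      by (simp add: coord_derivative_def)
  qed (simp add: coord_derivative_def)
qed

lemma chart_at: obtains U \<phi> where "(U, \<phi>) \<in> A" "p \<in> U"
proof -
  have "p \<in> (\<Union>(U, \<phi>)\<in>A. U)"
    using atlas by (simp add: smooth_atlas_def)
  then show thesis using that by auto
qed

text \<open>The definition collects vectors from all charts around \<open>p\<close>. A change of
  chart only changes the direction, so one chart yields them all; as a linear image of the
  coordinate space they form a subspace.\<close>

lemma tangent_space_eq_range:
  assumes "(U, \<phi>) \<in> A" "p \<in> U"
  shows "tangent_space A p = range (coord_derivative A (U, \<phi>) p)"
proof
  show "tangent_space A p \<subseteq> range (coord_derivative A (U, \<phi>) p)"
    unfolding tangent_space_def using coord_derivative_change[OF assms] by auto
  show "range (coord_derivative A (U, \<phi>) p) \<subseteq> tangent_space A p"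
    using assms unfolding tangent_space_def by force
qed

lemma subspace_tangent_space: "subspace (tangent_space A p)"
  by (metis chart_at linear_coord_derivative linear_subspace_image subspace_UNIV
      tangent_space_eq_range)

lemmas tangent_add = subspace_add[OF subspace_tangent_space]
  and tangent_scale = subspace_scale[OF subspace_tangent_space]
  and tangent_zero = subspace_0[OF subspace_tangent_space]

text \<open>Removes the derivative terms of real scalars and of constant metric products.\<close>

lemma tangent_const: "v \<in> tangent_space A p \<Longrightarrow> v (\<lambda>x. c) = 0"
  by (auto simp: tangent_space_def coord_derivative_def o_def)

section \<open>Vector fields\<close>

lemma smooth_field_tangent: "smooth_field A X \<Longrightarrow> X p \<in> tangent_space A p"
  by (simp add: smooth_field_def)

lemma smooth_field_apply: "smooth_field A X \<Longrightarrow> smooth_fun A f \<Longrightarrow> smooth_fun A (\<lambda>p. X p f)"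
  by (simp add: smooth_field_def)

lemma smooth_field_add: "smooth_field A X \<Longrightarrow> smooth_field A Y \<Longrightarrow> smooth_field A (X + Y)"
  by (simp add: smooth_field_def tangent_add smooth_fun_add)

lemma smooth_field_fun_scale: "smooth_fun A f \<Longrightarrow> smooth_field A X \<Longrightarrow> smooth_field A (fun_scale f X)"
  by (simp add: smooth_field_def fun_scale_def tangent_scale smooth_fun_mult)

lemma scaleR_field: "c *\<^sub>R X = fun_scale (\<lambda>_. c) X" for X :: "'b field"
  by (simp add: fun_scale_def fun_eq_iff)

lemma smooth_field_scaleR: "smooth_field A X \<Longrightarrow> smooth_field A (c *\<^sub>R X)"
  by (simp add: scaleR_field smooth_field_fun_scale)

lemma smooth_field_zero: "smooth_field A 0"
  by (simp add: smooth_field_def tangent_zero)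

lemma smooth_field_minus: "smooth_field A X \<Longrightarrow> smooth_field A (- X)"
  using smooth_field_scaleR[of X "-1"] by simp

lemma smooth_field_diff: "smooth_field A X \<Longrightarrow> smooth_field A Y \<Longrightarrow> smooth_field A (X - Y)"
  using smooth_field_add[of X "- Y"] by (simp add: smooth_field_minus)

lemma smooth_field_sum: "(\<And>i. i \<in> I \<Longrightarrow> smooth_field A (X i)) \<Longrightarrow> smooth_field A (\<Sum>i\<in>I. X i)"
  by (induction I rule: infinite_finite_induct) (auto intro: smooth_field_zero smooth_field_add)

end

section \<open>Tensoriality and contractions\<close>

lemmas pointwise = plus_fun_apply zero_fun_apply scaleR_fun_apply

text \<open>As simp rules these eta-expand fields and tangent vectors, so that the linearity rules for
  metrics and connections no longer match.\<close>

declare pointwise [simp del]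

lemma sum_fun_apply: "(\<Sum>i\<in>I. f i) x = (\<Sum>i\<in>I. f i x)"
  by (induction I rule: infinite_finite_induct) (auto simp: pointwise)

lemma fun_scale_add: "fun_scale f (X + Y) = fun_scale f X + fun_scale f Y"
  by (simp add: fun_scale_def fun_eq_iff distrib_left pointwise)

lemma fun_scale_minus: "fun_scale f (- X) = - fun_scale f X"
  by (simp add: fun_scale_def fun_eq_iff pointwise)

lemma fun_scale_diff: "fun_scale f (X - Y) = fun_scale f X - fun_scale f Y"
  using fun_scale_add[of f X "- Y"] by (simp add: fun_scale_minus)

text \<open>Linearity over the ring of smooth functions for operators with field values;
  \<open>tensorial\<close> is the counterpart for real values at one point.\<close>

definition field_linear ::
    "('a::topological_space, 'e::euclidean_space) chart set \<Rightarrow> ('a field \<Rightarrow> 'a field) \<Rightarrow> bool" where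
  "field_linear A T \<longleftrightarrow>
     (\<forall>X. smooth_field A X \<longrightarrow> smooth_field A (T X)) \<and>
     (\<forall>X Y. smooth_field A X \<longrightarrow> smooth_field A Y \<longrightarrow> T (X + Y) = T X + T Y) \<and>
     (\<forall>f X. smooth_fun A f \<longrightarrow> smooth_field A X \<longrightarrow> T (fun_scale f X) = fun_scale f (T X))"

definition tensorial ::
    "('a::topological_space, 'e::euclidean_space) chart set \<Rightarrow> 'a \<Rightarrow> ('a field \<Rightarrow> real) \<Rightarrow> bool" where
  "tensorial A p F \<longleftrightarrow>
     (\<forall>X Y. smooth_field A X \<longrightarrow> smooth_field A Y \<longrightarrow> F (X + Y) = F X + F Y) \<and>
     (\<forall>f X. smooth_fun A f \<longrightarrow> smooth_field A X \<longrightarrow> F (fun_scale f X) = f p * F X)"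

lemma tensorial_zero: "tensorial A p (\<lambda>X. 0)"
  by (simp add: tensorial_def)

lemma tensorial_add:
  "tensorial A p F \<Longrightarrow> tensorial A p F' \<Longrightarrow> tensorial A p (\<lambda>X. F X + F' X)"
  by (simp add: tensorial_def algebra_simps)

lemma tensorial_sum: "(\<And>i. i \<in> I \<Longrightarrow> tensorial A p (F i)) \<Longrightarrow> tensorial A p (\<lambda>X. \<Sum>i\<in>I. F i X)"
  by (induction I rule: infinite_finite_induct) (auto intro: tensorial_zero tensorial_add)

lemma tensorial_cmult: "tensorial A p F \<Longrightarrow> tensorial A p (\<lambda>X. c * F X)"
  by (simp add: tensorial_def algebra_simps)

text \<open>The common pattern of the three contracted quantities: the Ricci tensor is a single
  instance, the scalar curvature and the square norm are nested ones.\<close>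

definition contract ::
    "'a metric \<Rightarrow> 'a \<Rightarrow> ('n::finite \<Rightarrow> 'a field) \<Rightarrow> ('a field \<Rightarrow> 'a field \<Rightarrow> real) \<Rightarrow> real" where
  "contract h p E F = (\<Sum>i\<in>UNIV. \<Sum>j\<in>UNIV. inverse_metric h p E i j * F (E i) (E j))"

lemma tensorial_contract:
  "(\<And>i j. tensorial A p (\<lambda>X. F X (E i) (E j))) \<Longrightarrow> tensorial A p (\<lambda>X. contract h p E (F X))"
  unfolding contract_def by (intro tensorial_sum tensorial_cmult)

text \<open>Brings the frame indices \<open>k\<close>, \<open>l\<close> outside. The inner order,
  \<open>j\<close> before \<open>i\<close>, is the one in which an entry of
  \<open>transpose a ** M ** a\<close> unfolds.\<close>

lemma sum_swap_pairs:
  "(\<Sum>i\<in>I. \<Sum>j\<in>J. \<Sum>k\<in>K. \<Sum>l\<in>L. f i j k l) = (\<Sum>k\<in>K. \<Sum>l\<in>L. \<Sum>j\<in>J. \<Sum>i\<in>I. f i j k l)"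
proof -
  have "(\<Sum>i\<in>I. \<Sum>j\<in>J. \<Sum>k\<in>K. \<Sum>l\<in>L. f i j k l) = (\<Sum>i\<in>I. \<Sum>k\<in>K. \<Sum>l\<in>L. \<Sum>j\<in>J. f i j k l)"
    by (subst (2) sum.swap, subst (3) sum.swap) (rule refl)
  also have "\<dots> = (\<Sum>k\<in>K. \<Sum>l\<in>L. \<Sum>i\<in>I. \<Sum>j\<in>J. f i j k l)"
    by (subst sum.swap, subst (2) sum.swap) (rule refl)
  also have "\<dots> = (\<Sum>k\<in>K. \<Sum>l\<in>L. \<Sum>j\<in>J. \<Sum>i\<in>I. f i j k l)"
    by (subst (3) sum.swap) (rule refl)
  finally show ?thesis .
qed

section \<open>Inverse Gram matrices under a change of basis\<close>

lemma matrix_inv_eqI: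
  fixes G M :: "real^'n^'n"
  assumes "G ** M = mat 1"
  shows "matrix_inv G = M"
proof -
  have MG: "M ** G = mat 1"
    using assms by (simp add: matrix_left_right_inverse)
  \<comment> \<open>\<open>matrix_inv\<close> is a choice among two-sided inverses; the witness
    \<open>M\<close> secures its defining property, and uniqueness of inverses does the
    rest.\<close>
  have "G ** matrix_inv G = mat 1 \<and> matrix_inv G ** G = mat 1"
    unfolding matrix_inv_def by (rule someI[of _ M]) (simp add: assms MG)
  then have "matrix_inv G = (M ** G) ** matrix_inv G" "M ** (G ** matrix_inv G) = M"
    by (simp_all add: MG)
  then show ?thesis by (simp add: matrix_mul_assoc)
qed

text \<open>One-sided inverses of square matrices are two-sided, so \<open>a\<close> can be moved
  from the left end of a product equal to \<open>mat 1\<close> to its right end, where it completes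
  the claimed inverse of \<open>G\<close>.\<close>

lemma matrix_inv_congruence:
  fixes a G :: "real^'n^'n"
  assumes "invertible (a ** G ** transpose a)"
  shows "transpose a ** matrix_inv (a ** G ** transpose a) ** a = matrix_inv G"
proof -
  let ?M = "matrix_inv (a ** G ** transpose a)"
  obtain M where M: "(a ** G ** transpose a) ** M = mat 1"
    using assms by (auto simp: invertible_def)
  then have "?M = M" by (rule matrix_inv_eqI)
  with M have "a ** (G ** (transpose a ** ?M)) = mat 1"
    by (simp add: matrix_mul_assoc)
  then have "(G ** (transpose a ** ?M)) ** a = mat 1"
    by (simp add: matrix_left_right_inverse)
  then have "G ** (transpose a ** ?M ** a) = mat 1"
    by (simp add: matrix_mul_assoc)
  then show ?thesis by (rule matrix_inv_eqI[symmetric])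
qed

context manifold
begin

text \<open>The substitute for localisation: each coefficient function leaves \<open>F\<close> as
  its value at \<open>p\<close>.\<close>

lemma tensorial_combination:
  fixes F :: "'a field \<Rightarrow> real" and X :: "'k \<Rightarrow> 'a field" and a :: "'k \<Rightarrow> 'a \<Rightarrow> real"
  assumes F: "tensorial A p F" and X: "\<And>k. k \<in> I \<Longrightarrow> smooth_field A (X k)"
    and a: "\<And>k. k \<in> I \<Longrightarrow> smooth_fun A (a k)"
  shows "F (\<Sum>k\<in>I. fun_scale (a k) (X k)) = (\<Sum>k\<in>I. a k p * F (X k))"
proof -
  have F0: "F 0 = 0"
    using F smooth_field_zero unfolding tensorial_def by (metis add_cancel_right_right)
  show ?thesis
    using X a
  proof (induction I rule: infinite_finite_induct)
    case (insert k I)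
    then have "smooth_field A (fun_scale (a k) (X k))" "smooth_field A (\<Sum>k\<in>I. fun_scale (a k) (X k))"
      by (auto intro!: smooth_field_sum smooth_field_fun_scale)
    then have "F (fun_scale (a k) (X k) + (\<Sum>k\<in>I. fun_scale (a k) (X k)))
        = F (fun_scale (a k) (X k)) + F (\<Sum>k\<in>I. fun_scale (a k) (X k))"
      using F unfolding tensorial_def by blast
    moreover have "F (fun_scale (a k) (X k)) = a k p * F (X k)"
      using F insert.prems unfolding tensorial_def by blast
    moreover have "F (\<Sum>k\<in>I. fun_scale (a k) (X k)) = (\<Sum>k\<in>I. a k p * F (X k))"
      using insert by blast
    ultimately show ?case
      unfolding sum.insert[OF insert.hyps] by (simp only:)
  qed (auto simp: F0)
qed

end

context manifold
begin

lemma almost_complex_add: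
  assumes "almost_complex A J" "u \<in> tangent_space A p" "v \<in> tangent_space A p"
  shows "J p (u + v) = J p u + J p v"
proof -
  have "J p (1 *\<^sub>R u + 1 *\<^sub>R v) = 1 *\<^sub>R J p u + 1 *\<^sub>R J p v"
    using assms unfolding almost_complex_def by blast
  then show ?thesis by simp
qed

lemma almost_complex_scale:
  assumes "almost_complex A J" "u \<in> tangent_space A p"
  shows "J p (a *\<^sub>R u) = a *\<^sub>R J p u"
proof -
  have "J p (a *\<^sub>R u + 0 *\<^sub>R u) = a *\<^sub>R J p u + 0 *\<^sub>R J p u"
    using assms unfolding almost_complex_def by blast
  then show ?thesis by simp
qed

lemma almost_complex_smooth:
  "almost_complex A J \<Longrightarrow> smooth_field A Y \<Longrightarrow> smooth_field A (apply_endo J Y)"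
  unfolding almost_complex_def by blast

end

section \<open>Pointwise algebra of a pseudo-Riemannian metric\<close>

locale metric_manifold = manifold A
  for A :: "('a::{t2_space, second_countable_topology}, 'e::euclidean_space) chart set" +
  fixes h :: "'a metric"
  assumes metric: "pseudo_riemannian A h"
begin

lemma metric_sym: "u \<in> tangent_space A p \<Longrightarrow> v \<in> tangent_space A p \<Longrightarrow> h p u v = h p v u"
  using metric unfolding pseudo_riemannian_def by blast

lemma metric_comb:
  "u \<in> tangent_space A p \<Longrightarrow> v \<in> tangent_space A p \<Longrightarrow> w \<in> tangent_space A p \<Longrightarrow>
    h p (a *\<^sub>R u + b *\<^sub>R v) w = a * h p u w + b * h p v w"
  using metric unfolding pseudo_riemannian_def by blast

lemma metric_nondegenerate:
  "u \<in> tangent_space A p \<Longrightarrow> (\<And>v. v \<in> tangent_space A p \<Longrightarrow> h p u v = 0) \<Longrightarrow> u = 0"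
  using metric unfolding pseudo_riemannian_def by blast

lemma smooth_metric:
  "smooth_field A X \<Longrightarrow> smooth_field A Y \<Longrightarrow> smooth_fun A (\<lambda>p. h p (X p) (Y p))"
  using metric unfolding pseudo_riemannian_def by blast

lemma metric_add_left:
  "u \<in> tangent_space A p \<Longrightarrow> v \<in> tangent_space A p \<Longrightarrow> w \<in> tangent_space A p \<Longrightarrow>
    h p (u + v) w = h p u w + h p v w"
  using metric_comb[of u p v w 1 1] by simp

lemma metric_scale_left:
  "u \<in> tangent_space A p \<Longrightarrow> w \<in> tangent_space A p \<Longrightarrow> h p (a *\<^sub>R u) w = a * h p u w"
  using metric_comb[of u p u w a 0] by simp

lemma metric_add_right:
  "u \<in> tangent_space A p \<Longrightarrow> v \<in> tangent_space A p \<Longrightarrow> w \<in> tangent_space A p \<Longrightarrow>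
    h p w (u + v) = h p w u + h p w v"
  by (metis metric_add_left metric_sym tangent_add)

lemma metric_scale_right:
  "u \<in> tangent_space A p \<Longrightarrow> w \<in> tangent_space A p \<Longrightarrow> h p w (a *\<^sub>R u) = a * h p w u"
  by (metis metric_scale_left metric_sym tangent_scale)

lemma metric_zero_left: "w \<in> tangent_space A p \<Longrightarrow> h p 0 w = 0"
  using metric_scale_left[of w p w 0] by simp

lemma metric_sum_left:
  assumes "w \<in> tangent_space A p" "\<And>i. i \<in> I \<Longrightarrow> f i \<in> tangent_space A p"
  shows "h p (\<Sum>i\<in>I. c i *\<^sub>R f i) w = (\<Sum>i\<in>I. c i * h p (f i) w)"
  using assms(2)
proof (induction I rule: infinite_finite_induct)
  case (insert i I)
  then have "c i *\<^sub>R f i \<in> tangent_space A p" "(\<Sum>i\<in>I. c i *\<^sub>R f i) \<in> tangent_space A p"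
    by (auto intro!: tangent_scale subspace_sum[OF subspace_tangent_space])
  with insert assms(1) show ?case
    by (simp add: metric_add_left metric_scale_left)
qed (auto simp: metric_zero_left assms(1))

lemma metric_sum_right:
  assumes "w \<in> tangent_space A p" "\<And>i. i \<in> I \<Longrightarrow> f i \<in> tangent_space A p"
  shows "h p w (\<Sum>i\<in>I. c i *\<^sub>R f i) = (\<Sum>i\<in>I. c i * h p w (f i))"
proof -
  have "(\<Sum>i\<in>I. c i *\<^sub>R f i) \<in> tangent_space A p"
    using assms(2) by (auto intro!: tangent_scale subspace_sum[OF subspace_tangent_space])
  then have "h p w (\<Sum>i\<in>I. c i *\<^sub>R f i) = h p (\<Sum>i\<in>I. c i *\<^sub>R f i) w"
    by (rule metric_sym[OF assms(1)])
  also have "\<dots> = (\<Sum>i\<in>I. c i * h p (f i) w)"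
    by (rule metric_sum_left[OF assms])
  also have "\<dots> = (\<Sum>i\<in>I. c i * h p w (f i))"
    by (intro sum.cong refl) (simp add: metric_sym[OF assms(1)] assms(2))
  finally show ?thesis .
qed

lemma tensorial_metric_left:
  assumes "field_linear A T" "w \<in> tangent_space A p"
  shows "tensorial A p (\<lambda>X. h p (T X p) w)"
  using assms unfolding tensorial_def field_linear_def
  by (simp add: fun_scale_def pointwise metric_add_left metric_scale_left smooth_field_tangent)

lemma tensorial_metric_right:
  assumes "field_linear A T" "w \<in> tangent_space A p"
  shows "tensorial A p (\<lambda>X. h p w (T X p))"
  using assms unfolding tensorial_def field_linear_def
  by (simp add: fun_scale_def pointwise metric_add_right metric_scale_right smooth_field_tangent)

lemma field_linear_id: "field_linear A (\<lambda>X. X)"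
  by (simp add: field_linear_def)

end

section \<open>The Levi-Civita connection and linearity of its curvature\<close>

locale metric_connection = metric_manifold A h
  for A :: "('a::{t2_space, second_countable_topology}, 'e::euclidean_space) chart set" and h +
  fixes D :: "'a connection"
  assumes levi_civita: "levi_civita A h D"
begin

lemma affine: "affine_connection A D"
  using levi_civita unfolding levi_civita_def by blast

lemma smooth_D: "smooth_field A X \<Longrightarrow> smooth_field A Y \<Longrightarrow> smooth_field A (D X Y)"
  using affine unfolding affine_connection_def by blast

lemma D_add_left:
  "smooth_field A X \<Longrightarrow> smooth_field A Y \<Longrightarrow> smooth_field A Z \<Longrightarrow> D (X + Y) Z = D X Z + D Y Z"
  using affine unfolding affine_connection_def by blast

lemma D_add_right:
  "smooth_field A X \<Longrightarrow> smooth_field A Y \<Longrightarrow> smooth_field A Z \<Longrightarrow> D Z (X + Y) = D Z X + D Z Y"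
  using affine unfolding affine_connection_def by blast

lemma D_fun_scale_left:
  "smooth_field A X \<Longrightarrow> smooth_field A Y \<Longrightarrow> smooth_fun A f \<Longrightarrow>
    D (fun_scale f X) Y = fun_scale f (D X Y)"
  using affine unfolding affine_connection_def by blast

lemma D_fun_scale_right:
  "smooth_field A X \<Longrightarrow> smooth_field A Y \<Longrightarrow> smooth_fun A f \<Longrightarrow>
    D X (fun_scale f Y) = fun_scale (\<lambda>p. X p f) Y + fun_scale f (D X Y)"
  using affine unfolding affine_connection_def by blast

lemma bracket_D: "smooth_field A X \<Longrightarrow> smooth_field A Y \<Longrightarrow> lie_bracket X Y = D X Y - D Y X"
  using levi_civita unfolding levi_civita_def by metis

lemma D_metric:
  "smooth_field A X \<Longrightarrow> smooth_field A Y \<Longrightarrow> smooth_field A Z \<Longrightarrow>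
    X p (\<lambda>q. h q (Y q) (Z q)) = h p (D X Y p) (Z p) + h p (Y p) (D X Z p)"
  using levi_civita unfolding levi_civita_def by blast

lemma D_scaleR_left:
  "smooth_field A X \<Longrightarrow> smooth_field A Y \<Longrightarrow> D (c *\<^sub>R X) Y = c *\<^sub>R D X Y"
  by (simp add: scaleR_field D_fun_scale_left)

lemma D_scaleR_right:
  assumes "smooth_field A X" "smooth_field A Y"
  shows "D X (c *\<^sub>R Y) = c *\<^sub>R D X Y"
proof -
  have "fun_scale (\<lambda>p. X p (\<lambda>_. c)) Y = 0"
    using tangent_const[OF smooth_field_tangent[OF assms(1)]]
    by (simp add: fun_scale_def fun_eq_iff pointwise)
  then show ?thesis using assms by (simp add: scaleR_field D_fun_scale_right)
qed

lemma D_minus_left: "smooth_field A X \<Longrightarrow> smooth_field A Y \<Longrightarrow> D (- X) Y = - D X Y"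
  using D_scaleR_left[of X Y "-1"] by simp

lemma D_diff_left:
  "smooth_field A X \<Longrightarrow> smooth_field A Y \<Longrightarrow> smooth_field A Z \<Longrightarrow> D (X - Y) Z = D X Z - D Y Z"
  using D_add_left[of X "- Y" Z] by (simp add: D_minus_left smooth_field_minus)

lemma smooth_bracket: "smooth_field A X \<Longrightarrow> smooth_field A Y \<Longrightarrow> smooth_field A (lie_bracket X Y)"
  by (simp add: bracket_D smooth_D smooth_field_diff)

lemmas smooth_rules = smooth_D smooth_bracket smooth_field_add smooth_field_diff smooth_field_minus
  smooth_field_fun_scale smooth_field_scaleR smooth_field_zero smooth_field_apply

lemma smooth_curvature:
  "smooth_field A X \<Longrightarrow> smooth_field A Y \<Longrightarrow> smooth_field A Z \<Longrightarrow> smooth_field A (curvature D X Y Z)"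
  by (simp add: curvature_def smooth_rules)

lemma curvature_swap:
  assumes "smooth_field A X" "smooth_field A Y" "smooth_field A Z"
  shows "curvature D X Y Z = - curvature D Y X Z"
  using assms by (simp add: curvature_def bracket_D D_diff_left smooth_rules)

text \<open>Vanishing torsion turns the last term into \<open>D (D X Y - D Y X) Z\<close>. For
  \<open>fun_scale f X\<close> both this term and \<open>D Y (D X Z)\<close> produce the derivative
  of \<open>f\<close> along \<open>Y\<close> times \<open>D X Z\<close>, and the two cancel.\<close>

lemma field_linear_curvature_1:
  assumes [simp]: "smooth_field A Y" "smooth_field A Z"
  shows "field_linear A (\<lambda>X. curvature D X Y Z)"
  unfolding field_linear_def
proof (intro conjI allI impI)
  fix X assume [simp]: "smooth_field A X"
  show "smooth_field A (curvature D X Y Z)" by (simp add: smooth_curvature)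
  { fix X' assume [simp]: "smooth_field A X'"
    show "curvature D (X + X') Y Z = curvature D X Y Z + curvature D X' Y Z"
      by (simp add: curvature_def bracket_D D_add_left D_add_right D_diff_left smooth_rules) }
  { fix f assume [simp]: "smooth_fun A f"
    show "curvature D (fun_scale f X) Y Z = fun_scale f (curvature D X Y Z)"
      by (simp add: curvature_def bracket_D D_fun_scale_left D_fun_scale_right D_add_left
          D_diff_left smooth_rules fun_scale_diff) }
qed

lemma field_linear_uminus: "field_linear A T \<Longrightarrow> field_linear A (\<lambda>X. - T X)"
  by (simp add: field_linear_def fun_scale_minus smooth_rules)

lemma field_linear_cong:
  "field_linear A T \<Longrightarrow> (\<And>X. smooth_field A X \<Longrightarrow> T X = T' X) \<Longrightarrow> field_linear A T'"
  by (simp add: field_linear_def smooth_rules)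

lemma field_linear_curvature_2:
  assumes "smooth_field A X" "smooth_field A Z"
  shows "field_linear A (\<lambda>Y. curvature D X Y Z)"
  by (rule field_linear_cong[OF field_linear_uminus[OF field_linear_curvature_1[OF assms]]])
    (simp add: curvature_swap[of X] assms)

lemma field_linear_curvature_3:
  assumes [simp]: "smooth_field A X" "smooth_field A Y"
  shows "field_linear A (\<lambda>Z. curvature D X Y Z)"
  unfolding field_linear_def
proof (intro conjI allI impI)
  fix Z assume [simp]: "smooth_field A Z"
  show "smooth_field A (curvature D X Y Z)" by (simp add: smooth_curvature)
  { fix Z' assume [simp]: "smooth_field A Z'"
    show "curvature D X Y (Z + Z') = curvature D X Y Z + curvature D X Y Z'"
      by (simp add: curvature_def D_add_right smooth_rules) }
  { fix f assume [simp]: "smooth_fun A f"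
    \<comment> \<open>The mixed first-order Leibniz terms cancel in pairs. What remains is the
      second-order expression on the right, which the bracket term removes.\<close>
    have "fun_scale (\<lambda>p. lie_bracket X Y p f) Z =
        fun_scale (\<lambda>p. X p (\<lambda>q. Y q f)) Z - fun_scale (\<lambda>p. Y p (\<lambda>q. X q f)) Z"
      by (simp add: lie_bracket_def fun_scale_def fun_eq_iff left_diff_distrib pointwise)
    then show "curvature D X Y (fun_scale f Z) = fun_scale f (curvature D X Y Z)"
      by (simp add: curvature_def D_fun_scale_right D_add_right smooth_rules fun_scale_diff) }
qed

context
  fixes J :: "'a endo"
  assumes J: "almost_complex A J"
begin

lemma smooth_J: "smooth_field A Y \<Longrightarrow> smooth_field A (apply_endo J Y)"
  and J_field_add: "smooth_field A Y \<Longrightarrow> smooth_field A Z \<Longrightarrow>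
    apply_endo J (Y + Z) = apply_endo J Y + apply_endo J Z"
  and J_fun_scale: "smooth_field A Y \<Longrightarrow> smooth_fun A f \<Longrightarrow>
    apply_endo J (fun_scale f Y) = fun_scale f (apply_endo J Y)"
  using almost_complex_smooth[OF J]
  by (simp_all add: apply_endo_def fun_scale_def fun_eq_iff pointwise
      almost_complex_add[OF J] almost_complex_scale[OF J] smooth_field_tangent)

lemma field_linear_deriv_endo_1:
  "smooth_field A Y \<Longrightarrow> field_linear A (\<lambda>X. deriv_endo D J X Y)"
  by (simp add: field_linear_def deriv_endo_def smooth_J J_field_add J_fun_scale D_add_left
      D_fun_scale_left smooth_rules fun_scale_diff)

text \<open>Both summands of \<open>deriv_endo\<close> contribute the same Leibniz term,
  \<open>apply_endo J Y\<close> scaled by the derivative of \<open>f\<close> along \<open>X\<close>,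
  so it cancels.\<close>

lemma field_linear_deriv_endo_2:
  "smooth_field A X \<Longrightarrow> field_linear A (\<lambda>Y. deriv_endo D J X Y)"
  by (simp add: field_linear_def deriv_endo_def smooth_J J_field_add J_fun_scale D_add_right
      D_fun_scale_right smooth_rules fun_scale_diff)

end

end

section \<open>Independence of contractions from the basis\<close>

locale framed_metric_connection = metric_connection A h D
  for A :: "('a::{t2_space, second_countable_topology}, real ^ 'n::finite) chart set" and h D +
  fixes X :: "'n \<Rightarrow> 'a field"
  assumes frame: "\<And>p. basis_fields_at A p X"
    and frame_expand: "\<And>Y. smooth_field A Y \<Longrightarrow>
      \<exists>a. (\<forall>k. smooth_fun A (a k)) \<and> Y = (\<Sum>k\<in>UNIV. fun_scale (a k) (X k))"
begin

lemma smooth_frame: "smooth_field A (X i)"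
  using frame unfolding basis_fields_at_def by blast

text \<open>A kernel vector of the Gram matrix gives a tangent vector orthogonal to a basis.
  Nondegeneracy makes that vector zero, and independence makes its coefficients zero.\<close>

lemma gram_invertible:
  fixes E :: "'n \<Rightarrow> 'a field"
  assumes "basis_fields_at A p E"
  shows "invertible (\<chi> k l. h p (E k p) (E l p))" (is "invertible ?G")
proof -
  have inj: "inj (\<lambda>i. E i p)" and ind: "independent (range (\<lambda>i. E i p))"
    and span: "span (range (\<lambda>i. E i p)) = tangent_space A p"
    and E: "\<And>i. E i p \<in> tangent_space A p"
    using assms by (auto simp: basis_fields_at_def basis_family_def smooth_field_tangent)
  have "c = 0" if "?G *v c = 0" for c
  proof -
    define w where "w = (\<Sum>i\<in>UNIV. (c $ i) *\<^sub>R E i p)"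
    have w: "w \<in> tangent_space A p"
      unfolding w_def using E by (intro subspace_sum[OF subspace_tangent_space] tangent_scale)
    have Ew: "h p (E k p) w = 0" for k
      using arg_cong[OF that, of "\<lambda>v. v $ k"] E
      by (simp add: w_def metric_sum_right matrix_vector_mult_def mult.commute)
    have "v \<in> tangent_space A p \<and> h p v w = 0" if "v \<in> span (range (\<lambda>i. E i p))" for v
      using that
    proof (induction rule: span_induct_alt)
      case base
      then show ?case by (simp add: metric_zero_left w tangent_zero)
    next
      case (step a x y)
      then show ?case
        using metric_comb[of x p y w a 1] w Ew E by (auto simp: tangent_add tangent_scale)
    qed
    then have "w = 0"
      using metric_nondegenerate[OF w] w span by (metis metric_sym)
    \<comment> \<open>Independence speaks of sets of vectors, so the family is reindexed over its
      range.\<close>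
    moreover have "w = (\<Sum>v\<in>range (\<lambda>i. E i p). c $ inv (\<lambda>i. E i p) v *\<^sub>R v)"
      by (simp add: w_def sum.reindex[OF inj] inv_f_f[OF inj])
    ultimately have "c $ inv (\<lambda>i. E i p) (E i p) = 0" for i
      using independentD[OF ind, of "range (\<lambda>i. E i p)" "\<lambda>v. c $ inv (\<lambda>i. E i p) v" "E i p"] by auto
    then show "c = 0"
      by (simp add: vec_eq_iff inv_f_f[OF inj])
  qed
  then show ?thesis
    by (simp add: invertible_left_inverse matrix_left_invertible_ker)
qed

text \<open>Expanding \<open>E\<close> in the frame puts \<open>a\<close> and its transpose around
  the matrix of \<open>F\<close> and around the Gram matrix alike. The inverse Gram matrix absorbs
  both factors by \<open>matrix_inv_congruence\<close>.\<close>

lemma contract_frame: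
  fixes E :: "'n \<Rightarrow> 'a field"
  assumes E: "basis_fields_at A p E"
    and F1: "\<And>Y. smooth_field A Y \<Longrightarrow> tensorial A p (\<lambda>X. F X Y)"
    and F2: "\<And>X. smooth_field A X \<Longrightarrow> tensorial A p (F X)"
  shows "contract h p E F = contract h p X F"
proof -
  have smE: "smooth_field A (E i)" for i
    using E by (simp add: basis_fields_at_def)
  obtain b where b: "\<And>i k. smooth_fun A (b i k)" "\<And>i. E i = (\<Sum>k\<in>UNIV. fun_scale (b i k) (X k))"
    using frame_expand[OF smE] by metis
  define a where "a = (\<chi> i k. b i k p)"
  let ?G = "\<lambda>E. \<chi> k l. h p (E k p) (E l p)"
  have expand: "T (E i) = (\<Sum>k\<in>UNIV. a $ i $ k * T (X k))" if "tensorial A p T" for T i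
    using tensorial_combination[OF that, of UNIV X "b i"] b smooth_frame by (simp add: a_def)
  have expand2: "T (E i) (E j) = (\<Sum>k\<in>UNIV. \<Sum>l\<in>UNIV. a $ i $ k * a $ j $ l * T (X k) (X l))"
    if "\<And>Y. smooth_field A Y \<Longrightarrow> tensorial A p (\<lambda>X. T X Y)"
      "\<And>X. smooth_field A X \<Longrightarrow> tensorial A p (T X)" for T i j
  proof -
    have "T (X k) (E j) = (\<Sum>l\<in>UNIV. a $ j $ l * T (X k) (X l))" for k
      using expand[OF that(2)[OF smooth_frame[of k]]] by simp
    then show ?thesis
      using expand[OF that(1)[OF smE[of j]]] by (simp add: sum_distrib_left mult.assoc)
  qed
  have "?G E = a ** ?G X ** transpose a"
    by (simp add: vec_eq_iff matrix_matrix_mult_def transpose_def sum_distrib_right mult.assoc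
        expand2[of "\<lambda>Y Z. h p (Y p) (Z p)", OF tensorial_metric_left[OF field_linear_id]
          tensorial_metric_right[OF field_linear_id]] smooth_field_tangent)
      (subst sum.swap, simp add: mult_ac)
  then have inv: "transpose a ** matrix_inv (?G E) ** a = matrix_inv (?G X)"
    using matrix_inv_congruence gram_invertible[OF E] by metis
  have "contract h p E F = (\<Sum>i\<in>UNIV. \<Sum>j\<in>UNIV. \<Sum>k\<in>UNIV. \<Sum>l\<in>UNIV.
      matrix_inv (?G E) $ i $ j * (a $ i $ k * a $ j $ l * F (X k) (X l)))"
    by (simp add: contract_def inverse_metric_def expand2[OF F1 F2] sum_distrib_left)
  also have "\<dots> = (\<Sum>k\<in>UNIV. \<Sum>l\<in>UNIV. \<Sum>j\<in>UNIV. \<Sum>i\<in>UNIV.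
      matrix_inv (?G E) $ i $ j * (a $ i $ k * a $ j $ l * F (X k) (X l)))"
    by (rule sum_swap_pairs)
  also have "\<dots> = (\<Sum>k\<in>UNIV. \<Sum>l\<in>UNIV. (transpose a ** matrix_inv (?G E) ** a) $ k $ l * F (X k) (X l))"
    by (simp add: matrix_matrix_mult_def transpose_def sum_distrib_left sum_distrib_right mult_ac)
  also have "\<dots> = contract h p X F"
    by (simp add: contract_def inverse_metric_def inv)
  finally show ?thesis .
qed

text \<open>The frame is itself an admissible family at every point, so the condition is not vacuous
  and has exactly one solution.\<close>

lemma the_contraction:
  assumes "\<And>E. basis_fields_at A p E \<Longrightarrow> S E = S X"
  shows "(THE r. \<forall>E. basis_fields_at A p E \<longrightarrow> r = S E) = S X"
proof (rule the_equality)
  show "\<forall>E. basis_fields_at A p E \<longrightarrow> S X = S E"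
    using assms by metis
qed (use frame in blast)

lemma tensorial_curvature4:
  assumes [simp]: "smooth_field A V" "smooth_field A Y" "smooth_field A Z"
  shows "tensorial A p (\<lambda>U. curvature4 h D U V Y Z p)"
    and "tensorial A p (\<lambda>U. curvature4 h D V U Y Z p)"
    and "tensorial A p (\<lambda>U. curvature4 h D V Y U Z p)"
    and "tensorial A p (\<lambda>U. curvature4 h D V Y Z U p)"
  unfolding curvature4_def
  by (intro tensorial_metric_left tensorial_metric_right[of "\<lambda>X. X"] field_linear_curvature_1
      field_linear_curvature_2 field_linear_curvature_3 field_linear_id assms smooth_field_tangent
      smooth_curvature)+

lemma ricci_frame:
  assumes "smooth_field A Y" "smooth_field A Z"
  shows "ricci A h D Y Z p = contract h p X (\<lambda>U V. curvature4 h D U Y Z V p)"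
proof -
  let ?F = "\<lambda>U V. curvature4 h D U Y Z V p"
  have "(THE r. \<forall>E. basis_fields_at A p E \<longrightarrow> r = contract h p E ?F) = contract h p X ?F"
    by (rule the_contraction, rule contract_frame) (simp_all add: tensorial_curvature4 assms)
  then show ?thesis
    unfolding ricci_def contract_def .
qed

text \<open>Moving the inner Ricci values to the frame comes before the outer change of basis: it
  leaves an argument whose tensoriality follows from that of the curvature.\<close>

lemma scalar_curvature_frame:
  "scalar_curvature A h D p =
    contract h p X (\<lambda>Y Z. contract h p X (\<lambda>U V. curvature4 h D U Y Z V p))"
proof -
  let ?S = "\<lambda>Y Z. contract h p X (\<lambda>U V. curvature4 h D U Y Z V p)"
  have ric: "contract h p E (\<lambda>Y Z. ricci A h D Y Z p) = contract h p E ?S"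
    if "basis_fields_at A p E" for E :: "'n \<Rightarrow> 'a field"
    using that by (simp add: contract_def[of h p E] ricci_frame basis_fields_at_def)
  have "contract h p E ?S = contract h p X ?S" if "basis_fields_at A p E" for E :: "'n \<Rightarrow> 'a field"
    using that by (intro contract_frame tensorial_contract tensorial_curvature4 smooth_frame)
  then have "(THE r. \<forall>E. basis_fields_at A p E \<longrightarrow> r = contract h p E (\<lambda>Y Z. ricci A h D Y Z p))
      = contract h p X (\<lambda>Y Z. ricci A h D Y Z p)"
    by (intro the_contraction) (metis ric frame)
  then show ?thesis
    unfolding scalar_curvature_def contract_def[symmetric, of h p _ "\<lambda>Y Z. ricci A h D Y Z p"]
    using ric[OF frame] by simp
qed

text \<open>The inner contraction changes basis in the second slots \<open>Y\<close>,
  \<open>Z\<close> of \<open>deriv_endo\<close>, the outer one in the directions \<open>U\<close>,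
  \<open>V\<close>; each uses linearity in its own slot.\<close>

lemma square_norm_deriv_frame:
  assumes J: "almost_complex A J"
  shows "square_norm_deriv A J h D p =
    contract h p X (\<lambda>U V. contract h p X (\<lambda>Y Z. h p (deriv_endo D J U Y p) (deriv_endo D J V Z p)))"
proof -
  let ?Q = "\<lambda>U V Y Z. h p (deriv_endo D J U Y p) (deriv_endo D J V Z p)"
  let ?S = "\<lambda>U V. contract h p X (?Q U V)"
  have sm: "smooth_field A (deriv_endo D J U Y)" if "smooth_field A U" "smooth_field A Y" for U Y
    using field_linear_deriv_endo_1[OF J] that unfolding field_linear_def by blast
  have inner: "contract h p E (?Q U V) = ?S U V"
    if "basis_fields_at A p E" "smooth_field A U" "smooth_field A V"
    for E :: "'n \<Rightarrow> 'a field" and U V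
    using that
    by (intro contract_frame tensorial_metric_left tensorial_metric_right
        field_linear_deriv_endo_2[OF J] smooth_field_tangent sm)
  have outer: "contract h p E ?S = contract h p X ?S" if "basis_fields_at A p E"
    for E :: "'n \<Rightarrow> 'a field"
    using that
    by (intro contract_frame tensorial_contract tensorial_metric_left tensorial_metric_right
        field_linear_deriv_endo_1[OF J] smooth_field_tangent sm smooth_frame)
  have "contract h p E (\<lambda>U V. contract h p E (?Q U V)) = contract h p X ?S"
    if "basis_fields_at A p E" for E :: "'n \<Rightarrow> 'a field"
  proof -
    have "contract h p E (\<lambda>U V. contract h p E (?Q U V)) = contract h p E ?S"
      using that by (simp add: contract_def[of h p E "\<lambda>U V. contract h p _ (_ U V)"] inner
          basis_fields_at_def)
    then show ?thesis using outer[OF that] by simp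
  qed
  then have "(THE r. \<forall>E. basis_fields_at A p E \<longrightarrow> r = contract h p E (\<lambda>U V. contract h p E (?Q U V)))
      = contract h p X ?S"
    by (rule the_contraction[of p "\<lambda>E. contract h p E (\<lambda>U V. contract h p E (?Q U V))"])
  then show ?thesis
    unfolding square_norm_deriv_def contract_def by (simp add: sum_distrib_left mult.assoc)
qed

end

section \<open>Orthogonal frames\<close>

text \<open>The nonzero diagonal constants \<open>s\<close> let the product with \<open>X j\<close>
  isolate the coefficient of \<open>X j\<close>.\<close>

locale orthogonal_frame = metric_manifold A g
  for A :: "('a::{t2_space, second_countable_topology}, real ^ 'n::finite) chart set" and g +
  fixes X :: "'n \<Rightarrow> 'a field" and s :: "'n \<Rightarrow> real"
  assumes smooth_frame: "\<And>i. smooth_field A (X i)"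
    and orthogonal: "\<And>p i j. g p (X i p) (X j p) = (if i = j then s i else 0)"
    and s_nonzero: "\<And>i. s i \<noteq> 0"
begin

lemma frame_tangent: "X i p \<in> tangent_space A p"
  by (rule smooth_field_tangent[OF smooth_frame])

lemma metric_coefficient: "g p (\<Sum>i\<in>UNIV. c i *\<^sub>R X i p) (X j p) = c j * s j"
  by (simp add: metric_sum_left frame_tangent orthogonal if_distrib cong: if_cong)

lemma frame_coefficients_zero: "(\<Sum>i\<in>UNIV. c i *\<^sub>R X i p) = 0 \<Longrightarrow> c j = 0"
  using metric_coefficient[of p c j] s_nonzero[of j]
  by (simp add: metric_zero_left frame_tangent)

text \<open>A chart presents the tangent space as a linear image of \<open>real ^ 'n\<close>. Preimages of the frame
  vectors are independent, hence span \<open>real ^ 'n\<close>.\<close>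

lemma tangent_expand:
  assumes "v \<in> tangent_space A p"
  shows "v = (\<Sum>i\<in>UNIV. (g p v (X i p) / s i) *\<^sub>R X i p)"
proof -
  obtain U \<phi> where c: "(U, \<phi>) \<in> A" "p \<in> U" by (rule chart_at)
  let ?L = "coord_derivative A (U, \<phi>) p"
  have lin: "linear ?L" by (rule linear_coord_derivative[OF c])
  have "\<exists>u. X i p = ?L u" for i
    using frame_tangent[of i p] tangent_space_eq_range[OF c] by auto
  then obtain u where u: "\<And>i. X i p = ?L (u i)" by metis
  define M where "M c = (\<Sum>i\<in>UNIV. (c $ i) *\<^sub>R u i)" for c :: "real ^ 'n"
  have linM: "linear M"
    by (rule linearI)
      (simp_all add: M_def sum.distrib scaleR_left_distrib scaleR_sum_right)
  have LM: "?L (M c) = (\<Sum>i\<in>UNIV. (c $ i) *\<^sub>R X i p)" for c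
    by (simp add: M_def linear_sum[OF lin] linear_scale[OF lin] u)
  have "c = 0" if "M c = 0" for c
    using LM[of c] that linear_0[OF lin] frame_coefficients_zero[of "\<lambda>i. c $ i" p]
    by (simp add: vec_eq_iff)
  then have "inj M"
    using linear_injective_0[OF linM] by blast
  then have "surj M"
    using linear_injective_imp_surjective[OF linM] by simp
  moreover obtain w where "v = ?L w"
    using assms tangent_space_eq_range[OF c] by auto
  ultimately obtain b where "v = ?L (M b)" by (metis surjD)
  then have v: "v = (\<Sum>i\<in>UNIV. (b $ i) *\<^sub>R X i p)" by (simp add: LM)
  then have "g p v (X i p) = b $ i * s i" for i
    using metric_coefficient by simp
  then show ?thesis using v s_nonzero by simp
qed

lemma basis_frame: "basis_fields_at A p X"
proof -
  have inj: "inj (\<lambda>i. X i p)"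
  proof (rule injI)
    fix i j assume "X i p = X j p"
    then show "i = j"
      using orthogonal[of p i i] orthogonal[of p j i] s_nonzero[of i] by (auto split: if_splits)
  qed
  have "c v = 0" if sum: "(\<Sum>x\<in>range (\<lambda>i. X i p). c x *\<^sub>R x) = 0"
    and mem: "v \<in> range (\<lambda>i. X i p)" for c v
  proof -
    obtain j where v: "v = X j p" using mem by auto
    have "(\<Sum>i\<in>UNIV. c (X i p) *\<^sub>R X i p) = 0"
      using sum by (simp add: sum.reindex[OF inj])
    then show "c v = 0"
      unfolding v by (rule frame_coefficients_zero[of "\<lambda>i. c (X i p)"])
  qed
  note coefficients_zero = this
  have "independent (range (\<lambda>i. X i p))"
  proof
    assume "dependent (range (\<lambda>i. X i p))"
    then obtain c v where "(\<Sum>x\<in>range (\<lambda>i. X i p). c x *\<^sub>R x) = 0"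
      "v \<in> range (\<lambda>i. X i p)" "c v \<noteq> 0"
      by (auto simp: dependent_finite)
    then show False using coefficients_zero[of c v] by simp
  qed
  moreover have "span (range (\<lambda>i. X i p)) = tangent_space A p"
  proof
    show "span (range (\<lambda>i. X i p)) \<subseteq> tangent_space A p"
      using frame_tangent by (intro span_minimal subspace_tangent_space) auto
    show "tangent_space A p \<subseteq> span (range (\<lambda>i. X i p))"
    proof
      fix v assume "v \<in> tangent_space A p"
      then show "v \<in> span (range (\<lambda>i. X i p))"
        by (subst tangent_expand) (assumption, intro span_sum span_scale span_base rangeI)
    qed
  qed
  ultimately show ?thesis
    using inj smooth_frame by (simp add: basis_fields_at_def basis_family_def)
qed

lemma smooth_expand:
  assumes "smooth_field A Y"
  shows "\<exists>a. (\<forall>k. smooth_fun A (a k)) \<and> Y = (\<Sum>k\<in>UNIV. fun_scale (a k) (X k))"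
proof (intro exI conjI allI)
  \<comment> \<open>The quotient is written as a product with a constant, a form covered by
    smoothness of products.\<close>
  let ?a = "\<lambda>k p. g p (Y p) (X k p) * (1 / s k)"
  show "smooth_fun A (?a k)" for k
    by (intro smooth_fun_mult smooth_metric assms smooth_frame smooth_fun_const)
  show "Y = (\<Sum>k\<in>UNIV. fun_scale (?a k) (X k))"
  proof
    fix p
    show "Y p = (\<Sum>k\<in>UNIV. fun_scale (?a k) (X k)) p"
      using tangent_expand[OF smooth_field_tangent[OF assms], of p]
      by (simp add: sum_fun_apply fun_scale_def)
  qed
qed

end

section \<open>The twin metric\<close>

text \<open>A normal form for constant coefficients. The value type is general so that it serves
  both for fields and for tangent vectors at a point.\<close>

definition lincomb :: "(4 \<Rightarrow> 'b::real_vector) \<Rightarrow> real \<Rightarrow> real \<Rightarrow> real \<Rightarrow> real \<Rightarrow> 'b" where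
  "lincomb X a b c d = a *\<^sub>R X 1 + b *\<^sub>R X 2 + c *\<^sub>R X 3 + d *\<^sub>R X 4"

text \<open>For a fixed \<open>X\<close> these can be used as rewrite rules: the right-hand sides
  contain \<open>X\<close> unapplied, so rewriting does not loop.\<close>

lemma lincomb_frame:
  "X 1 = lincomb X 1 0 0 0" "X 2 = lincomb X 0 1 0 0" "X 3 = lincomb X 0 0 1 0" "X 4 = lincomb X 0 0 0 1"
  by (simp_all add: lincomb_def)

lemma lincomb_diff:
  "lincomb X a b c d - lincomb X a' b' c' d' = lincomb X (a - a') (b - b') (c - c') (d - d')"
  by (simp add: lincomb_def algebra_simps)

lemma lincomb_apply: "lincomb X a b c d p = lincomb (\<lambda>i. X i p) a b c d"
  by (simp add: lincomb_def pointwise)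

locale norden_frame = metric_manifold A g
  for A :: "('a::{t2_space, second_countable_topology}, real ^ 4) chart set" and g +
  fixes X :: "4 \<Rightarrow> 'a field" and J :: "'a endo"
  assumes smooth_X: "\<And>i. smooth_field A (X i)"
    and J: "almost_complex A J"
    and J_frame: "apply_endo J (X 1) = X 3" "apply_endo J (X 2) = X 4"
      "apply_endo J (X 3) = - X 1" "apply_endo J (X 4) = - X 2"
    and g_pos: "\<And>p. g p (X 1 p) (X 1 p) = 1" "\<And>p. g p (X 2 p) (X 2 p) = 1"
    and g_neg: "\<And>p. g p (X 3 p) (X 3 p) = - 1" "\<And>p. g p (X 4 p) (X 4 p) = - 1"
    and g_orth: "\<And>p i j. i \<noteq> j \<Longrightarrow> g p (X i p) (X j p) = 0"
begin

sublocale orthogonal_frame A g X "\<lambda>i. if i = 1 \<or> i = 2 then 1 else - 1"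
proof
  fix p and i j :: 4
  show "g p (X i p) (X j p) = (if i = j then if i = 1 \<or> i = 2 then 1 else - 1 else 0)"
    using exhaust_4[of i] g_pos g_neg g_orth[of i j] by auto
qed (auto simp: smooth_X)

lemma tangent_lincomb:
  assumes "v \<in> tangent_space A p" obtains a b c d where "v = lincomb (\<lambda>i. X i p) a b c d"
  using tangent_expand[OF assms] that unfolding sum_4 lincomb_def by blast

lemma g_lincomb:
  "g p (lincomb (\<lambda>i. X i p) a1 a2 a3 a4) (lincomb (\<lambda>i. X i p) b1 b2 b3 b4) =
    a1 * b1 + a2 * b2 - a3 * b3 - a4 * b4"
  by (simp add: lincomb_def metric_add_left metric_add_right metric_scale_left metric_scale_right
      tangent_add tangent_scale frame_tangent g_pos g_neg g_orth)

lemma J_lincomb: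
  "J p (lincomb (\<lambda>i. X i p) a b c d) = lincomb (\<lambda>i. X i p) (- c) (- d) a b"
proof -
  have "J p (X 1 p) = X 3 p" "J p (X 2 p) = X 4 p" "J p (X 3 p) = - X 1 p" "J p (X 4 p) = - X 2 p"
    using J_frame by (simp_all add: apply_endo_def fun_eq_iff)
  then show ?thesis
    by (simp add: lincomb_def almost_complex_add[OF J] almost_complex_scale[OF J]
        tangent_add tangent_scale frame_tangent)
qed

abbreviation twin :: "'a metric" where "twin \<equiv> \<lambda>p u v. g p u (J p v)"

lemma twin_lincomb:
  "twin p (lincomb (\<lambda>i. X i p) a1 a2 a3 a4) (lincomb (\<lambda>i. X i p) b1 b2 b3 b4) =
    - (a1 * b3 + a3 * b1 + a2 * b4 + a4 * b2)"
  by (simp add: J_lincomb g_lincomb)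

lemma twin_sym: "u \<in> tangent_space A p \<Longrightarrow> v \<in> tangent_space A p \<Longrightarrow> twin p u v = twin p v u"
  by (elim tangent_lincomb) (simp add: twin_lincomb)

lemma twin_J: "u \<in> tangent_space A p \<Longrightarrow> v \<in> tangent_space A p \<Longrightarrow> twin p (J p u) (J p v) = - twin p u v"
  by (elim tangent_lincomb) (simp add: J_lincomb g_lincomb)

lemma twin_pseudo_riemannian: "pseudo_riemannian A twin"
proof -
  have Jt: "J p u \<in> tangent_space A p" and JJ: "J p (J p u) = - u" if "u \<in> tangent_space A p" for p u
    using J that unfolding almost_complex_def by blast+
  have nondeg: "u = 0" if u: "u \<in> tangent_space A p" and "\<forall>v\<in>tangent_space A p. twin p u v = 0" for p u
  proof (rule metric_nondegenerate[OF u])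
    fix v assume v: "v \<in> tangent_space A p"
    \<comment> \<open>Every \<open>v\<close> is minus the image of \<open>J p v\<close> under
      \<open>J p\<close>, so orthogonality for the twin metric gives orthogonality for
      \<open>g\<close>.\<close>
    have "g p u (J p (J p v)) = 0"
      using that(2) Jt[OF v] by blast
    then show "g p u v = 0"
      using metric_scale_right[OF v u, of "-1"] by (simp add: JJ[OF v])
  qed
  have "smooth_fun A (\<lambda>p. twin p (Y p) (Z p))" if "smooth_field A Y" "smooth_field A Z" for Y Z
    using smooth_metric[OF that(1) almost_complex_smooth[OF J that(2)]]
    by (simp add: apply_endo_def)
  then show ?thesis
    unfolding pseudo_riemannian_def using twin_sym metric_comb Jt nondeg by simp
qed

lemma twin_norden: "norden_metric A J twin"
  using J twin_pseudo_riemannian twin_J by (simp add: norden_metric_def)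

end

section \<open>Square norm and scalar curvature\<close>

context metric_connection
begin

text \<open>With all three products constant, metric compatibility loses its derivative terms and
  makes \<open>h p (D U V p) (W p)\<close> skew in \<open>V\<close> and \<open>W\<close>. Vanishing
  torsion then leaves only brackets.\<close>

lemma koszul:
  assumes "smooth_field A U" "smooth_field A V" "smooth_field A W"
    and const: "\<And>q. h q (U q) (V q) = a" "\<And>q. h q (V q) (W q) = b" "\<And>q. h q (U q) (W q) = c"
  shows "2 * h p (D U V p) (W p) = h p (lie_bracket U V p) (W p) +
    h p (lie_bracket W U p) (V p) + h p (lie_bracket W V p) (U p)"
proof -
  have "h p (lie_bracket Y Z p) (T p) = h p (D Y Z p) (T p) - h p (D Z Y p) (T p)"
    if "smooth_field A Y" "smooth_field A Z" "smooth_field A T" for Y Z T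
  proof -
    have *: "Y' p \<in> tangent_space A p" if "smooth_field A Y'" for Y'
      using that by (rule smooth_field_tangent)
    have "h p (D Y Z p) (T p) = h p (lie_bracket Y Z p + D Z Y p) (T p)"
      using that by (simp add: bracket_D)
    also have "\<dots> = h p (lie_bracket Y Z p) (T p) + h p (D Z Y p) (T p)"
      using that by (intro metric_add_left * smooth_rules)
    finally show ?thesis by simp
  qed
  note br = this
  have "h p (D U V p) (W p) + h p (V p) (D U W p) = 0"
    "h p (D V U p) (W p) + h p (U p) (D V W p) = 0"
    "h p (D W U p) (V p) + h p (U p) (D W V p) = 0"
    using D_metric[of U V W p] D_metric[of V U W p] D_metric[of W U V p] assms
    by (simp_all add: tangent_const[OF smooth_field_tangent])
  moreover have "h p (V p) (D U W p) = h p (D U W p) (V p)" "h p (U p) (D V W p) = h p (D V W p) (U p)"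
    "h p (U p) (D W V p) = h p (D W V p) (U p)"
    using assms by (simp_all add: metric_sym smooth_field_tangent smooth_D)
  ultimately show ?thesis
    using assms by (simp add: br)
qed

lemma bracket_swap: "lie_bracket U V = - lie_bracket V U"
  by (simp add: lie_bracket_def fun_eq_iff)

text \<open>Vanishing torsion expresses brackets through \<open>D\<close>, from which they inherit
  bilinearity over the reals.\<close>

lemma bracket_add_left:
  "smooth_field A U \<Longrightarrow> smooth_field A V \<Longrightarrow> smooth_field A W \<Longrightarrow>
    lie_bracket (U + V) W = lie_bracket U W + lie_bracket V W"
  by (simp add: bracket_D smooth_rules D_add_left D_add_right)

lemma bracket_scaleR_left:
  "smooth_field A U \<Longrightarrow> smooth_field A W \<Longrightarrow> lie_bracket (c *\<^sub>R U) W = c *\<^sub>R lie_bracket U W"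
  by (simp add: bracket_D smooth_rules D_scaleR_left D_scaleR_right scaleR_diff_right)

lemma bracket_add_right:
  "smooth_field A U \<Longrightarrow> smooth_field A V \<Longrightarrow> smooth_field A W \<Longrightarrow>
    lie_bracket W (U + V) = lie_bracket W U + lie_bracket W V"
  by (simp add: bracket_D smooth_rules D_add_left D_add_right)

lemma bracket_scaleR_right:
  "smooth_field A U \<Longrightarrow> smooth_field A W \<Longrightarrow> lie_bracket W (c *\<^sub>R U) = c *\<^sub>R lie_bracket W U"
  by (simp add: bracket_D smooth_rules D_scaleR_left D_scaleR_right scaleR_diff_right)

end

section \<open>Explicit calculation with constant coefficients\<close>

locale twin_connection = framed_metric_connection A h D X
  for A :: "('a::{t2_space, second_countable_topology}, real ^ 4) chart set" and h D X +
  fixes J :: "'a endo" and l1 l2 l3 l4 :: real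
  assumes J: "almost_complex A J"
    and J_lincomb: "\<And>p a b c d. J p (lincomb (\<lambda>i. X i p) a b c d) = lincomb (\<lambda>i. X i p) (- c) (- d) a b"
    and h_lincomb: "\<And>p a1 a2 a3 a4 b1 b2 b3 b4.
      h p (lincomb (\<lambda>i. X i p) a1 a2 a3 a4) (lincomb (\<lambda>i. X i p) b1 b2 b3 b4) =
        - (a1 * b3 + a3 * b1 + a2 * b4 + a4 * b2)"
    and b13: "lie_bracket (X 1) (X 3) = l2 *\<^sub>R X 2 + l4 *\<^sub>R X 4"
    and b24: "lie_bracket (X 2) (X 4) = l1 *\<^sub>R X 1 + l3 *\<^sub>R X 3"
    and b23: "lie_bracket (X 2) (X 3) = - l2 *\<^sub>R X 1 - l3 *\<^sub>R X 4"
    and b34: "lie_bracket (X 3) (X 4) = - l4 *\<^sub>R X 1 + l3 *\<^sub>R X 2"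
    and b41: "lie_bracket (X 4) (X 1) = l1 *\<^sub>R X 2 + l4 *\<^sub>R X 3"
    and b21: "lie_bracket (X 2) (X 1) = - l2 *\<^sub>R X 3 + l1 *\<^sub>R X 4"
begin

lemma smooth_lincomb: "smooth_field A (lincomb X a b c d)"
  by (simp add: lincomb_def smooth_rules smooth_frame)

lemma J_lincomb_field: "apply_endo J (lincomb X a b c d) = lincomb X (- c) (- d) a b"
  by (simp add: apply_endo_def fun_eq_iff lincomb_apply J_lincomb)

lemma bracket_lincomb:
  "lie_bracket (lincomb X a1 a2 a3 a4) (lincomb X b1 b2 b3 b4) = lincomb X
      (l1 * a2 * b4 - l1 * a4 * b2 - l2 * a2 * b3 + l2 * a3 * b2 - l4 * a3 * b4 + l4 * a4 * b3)
      (- l1 * a1 * b4 + l1 * a4 * b1 + l2 * a1 * b3 - l2 * a3 * b1 + l3 * a3 * b4 - l3 * a4 * b3)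
      (l2 * a1 * b2 - l2 * a2 * b1 + l3 * a2 * b4 - l3 * a4 * b2 - l4 * a1 * b4 + l4 * a4 * b1)
      (- l1 * a1 * b2 + l1 * a2 * b1 - l3 * a2 * b3 + l3 * a3 * b2 + l4 * a1 * b3 - l4 * a3 * b1)"
proof -
  have self: "lie_bracket V V = 0" for V :: "'a field"
    by (simp add: lie_bracket_def fun_eq_iff pointwise)
  note swapped = b13 b24 b23 b34 b41 b21 bracket_swap[of "X 3" "X 1"] bracket_swap[of "X 4" "X 2"]
    bracket_swap[of "X 3" "X 2"] bracket_swap[of "X 4" "X 3"] bracket_swap[of "X 1" "X 4"]
    bracket_swap[of "X 1" "X 2"]
  show ?thesis
    by (simp add: lincomb_def bracket_add_left bracket_add_right bracket_scaleR_left
        bracket_scaleR_right smooth_rules smooth_frame self swapped)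
      (simp add: fun_eq_iff pointwise algebra_simps)
qed

text \<open>By \<open>h_lincomb\<close>, \<open>X 1\<close> pairs with \<open>X 3\<close> and
  \<open>X 2\<close> with \<open>X 4\<close>, each with value -1, and all other frame products
  vanish. A coefficient is therefore minus the product with the partner of its frame field.\<close>

lemma lincomb_eqI:
  assumes V: "smooth_field A V"
    and "\<And>p. h p (V p) (X 3 p) = - a" "\<And>p. h p (V p) (X 4 p) = - b"
      "\<And>p. h p (V p) (X 1 p) = - c" "\<And>p. h p (V p) (X 2 p) = - d"
  shows "V = lincomb X a b c d"
proof
  fix p
  obtain f where "V = (\<Sum>k\<in>UNIV. fun_scale (f k) (X k))"
    using frame_expand[OF V] by blast
  then have Vp: "V p = lincomb (\<lambda>i. X i p) (f 1 p) (f 2 p) (f 3 p) (f 4 p)"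
    by (simp add: sum_4 lincomb_def fun_scale_def pointwise)
  have "h p (lincomb (\<lambda>i. X i p) (f 1 p) (f 2 p) (f 3 p) (f 4 p)) (X 1 p) = - f 3 p"
    "h p (lincomb (\<lambda>i. X i p) (f 1 p) (f 2 p) (f 3 p) (f 4 p)) (X 2 p) = - f 4 p"
    "h p (lincomb (\<lambda>i. X i p) (f 1 p) (f 2 p) (f 3 p) (f 4 p)) (X 3 p) = - f 1 p"
    "h p (lincomb (\<lambda>i. X i p) (f 1 p) (f 2 p) (f 3 p) (f 4 p)) (X 4 p) = - f 2 p"
    using lincomb_frame[of "\<lambda>i. X i p"] h_lincomb by simp_all
  then show "V p = lincomb X a b c d p"
    using assms(2-5)[of p] by (simp add: Vp lincomb_apply)
qed

lemma h_lincomb_field: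
  "h p (lincomb X a1 a2 a3 a4 p) (lincomb X b1 b2 b3 b4 p) = - (a1 * b3 + a3 * b1 + a2 * b4 + a4 * b2)"
  by (simp only: lincomb_apply h_lincomb)

lemma koszul_lincomb:
  "h p (D (lincomb X a1 a2 a3 a4) (lincomb X b1 b2 b3 b4) p) (lincomb X c1 c2 c3 c4 p) =
    (h p (lie_bracket (lincomb X a1 a2 a3 a4) (lincomb X b1 b2 b3 b4) p) (lincomb X c1 c2 c3 c4 p) +
     h p (lie_bracket (lincomb X c1 c2 c3 c4) (lincomb X a1 a2 a3 a4) p) (lincomb X b1 b2 b3 b4 p) +
     h p (lie_bracket (lincomb X c1 c2 c3 c4) (lincomb X b1 b2 b3 b4) p) (lincomb X a1 a2 a3 a4 p)) / 2"
  using koszul[OF smooth_lincomb smooth_lincomb smooth_lincomb h_lincomb_field h_lincomb_field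
      h_lincomb_field, of p] by (simp only: field_simps)

text \<open>The coefficients are minus the halved Koszul sums with third field \<open>X 3\<close>,
  \<open>X 4\<close>, \<open>X 1\<close>, \<open>X 2\<close> in turn. The result is again a
  \<open>lincomb\<close>, so the rule can be iterated in the curvature.\<close>

lemma D_lincomb:
  "D (lincomb X a1 a2 a3 a4) (lincomb X b1 b2 b3 b4) = lincomb X
      (1/2 * l1 * a2 * b4 - 1/2 * l1 * a4 * b2 - 1/2 * l2 * a1 * b4 + l2 * a3 * b2 - 1/2 * l2 * a4 * b1 + l3 * a2 * b2
        + l3 * a4 * b4 - 1/2 * l4 * a1 * b2 - 1/2 * l4 * a2 * b1 - l4 * a3 * b4)
      (- 1/2 * l1 * a2 * b3 - 1/2 * l1 * a3 * b2 + l1 * a4 * b1 + 1/2 * l2 * a1 * b3 - 1/2 * l2 * a3 * b1 - 1/2 * l3 * a1 * b2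
        - 1/2 * l3 * a2 * b1 - l3 * a4 * b3 + l4 * a1 * b1 + l4 * a3 * b3)
      (- l1 * a2 * b2 - l1 * a4 * b4 + l2 * a1 * b2 + 1/2 * l2 * a3 * b4 + 1/2 * l2 * a4 * b3 + 1/2 * l3 * a2 * b4
        - 1/2 * l3 * a4 * b2 - l4 * a1 * b4 + 1/2 * l4 * a2 * b3 + 1/2 * l4 * a3 * b2)
      (l1 * a2 * b1 + 1/2 * l1 * a3 * b4 + 1/2 * l1 * a4 * b3 - l2 * a1 * b1 - l2 * a3 * b3 + 1/2 * l3 * a1 * b4
        - l3 * a2 * b3 + 1/2 * l3 * a4 * b1 + 1/2 * l4 * a1 * b3 - 1/2 * l4 * a3 * b1)"
  by (rule lincomb_eqI[OF smooth_D[OF smooth_lincomb smooth_lincomb]])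
    (simp_all only: lincomb_frame[of X] koszul_lincomb bracket_lincomb h_lincomb_field,
     simp_all add: field_simps)

lemma inverse_metric_frame:
  "inverse_metric h p X i j = (if (i, j) \<in> {(1, 3), (3, 1), (2, 4), (4, 2)} then - 1 else 0)"
proof -
  let ?M = "(\<chi> i j. if (i, j) \<in> {(1, 3), (3, 1), (2, 4), (4, 2)} then - 1 else 0) :: real ^ 4 ^ 4"
  have "h p (X i p) (X j p) = ?M $ i $ j" for i j
    using exhaust_4[of i] exhaust_4[of j] h_lincomb_field[of p]
    by (auto simp: lincomb_frame[of X])
  then have G: "(\<chi> k l. h p (X k p) (X l p)) = ?M"
    by (simp add: vec_eq_iff)
  \<comment> \<open>\<open>?M\<close> is minus the permutation matrix of an involution, hence its
    own inverse.\<close>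
  have "?M ** ?M = mat 1"
    by (simp add: vec_eq_iff matrix_matrix_mult_def mat_def forall_4 sum_4)
  then show ?thesis
    using matrix_inv_eqI[of ?M ?M] by (simp add: inverse_metric_def G)
qed

lemma contract_pairs:
  "contract h p X F = - (F (X 1) (X 3) + F (X 3) (X 1) + F (X 2) (X 4) + F (X 4) (X 2))"
  by (simp add: contract_def sum_4 inverse_metric_frame)

text \<open>Two nested contractions of four terms give sixteen curvature values, each a polynomial
  in the structure constants. Only the mixed products \<open>l1 * l3\<close> and
  \<open>l2 * l4\<close> survive in the sum.\<close>

lemma scalar_curvature_eq: "scalar_curvature A h D p = - 5 * (l1 * l3 + l2 * l4)"
  unfolding scalar_curvature_frame contract_pairs lincomb_frame[of X] curvature4_def curvature_def
    bracket_lincomb D_lincomb lincomb_diff h_lincomb_field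
  by (simp add: algebra_simps)

lemma square_norm_deriv_eq: "square_norm_deriv A J h D p = - 8 * (l1 * l3 + l2 * l4)"
  unfolding square_norm_deriv_frame[OF J] contract_pairs lincomb_frame[of X] deriv_endo_def
    J_lincomb_field D_lincomb lincomb_diff h_lincomb_field
  by (simp add: algebra_simps)

end

theorem proposition3p6:
  fixes A :: "('a::{t2_space, second_countable_topology}, real ^ 4) chart set"
    and mul :: "'a \<Rightarrow> 'a \<Rightarrow> 'a" and e :: 'a and invr :: "'a \<Rightarrow> 'a"
    and X :: "4 \<Rightarrow> 'a field"
    and l\<^sub>1 l\<^sub>2 l\<^sub>3 l\<^sub>4 :: real
    and J :: "'a endo" and g g' :: "'a metric" and D :: "'a connection"
  assumes lie: "lie_group A mul e invr"
    and connected: "connected (UNIV :: 'a set)"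
    and basis: "basis_family (lie_algebra A mul) X"
    and b13: "lie_bracket (X 1) (X 3) = l\<^sub>2 *\<^sub>R X 2 + l\<^sub>4 *\<^sub>R X 4"
    and b24: "lie_bracket (X 2) (X 4) = l\<^sub>1 *\<^sub>R X 1 + l\<^sub>3 *\<^sub>R X 3"
    and b23: "lie_bracket (X 2) (X 3) = - l\<^sub>2 *\<^sub>R X 1 - l\<^sub>3 *\<^sub>R X 4"
    and b34: "lie_bracket (X 3) (X 4) = - l\<^sub>4 *\<^sub>R X 1 + l\<^sub>3 *\<^sub>R X 2"
    and b41: "lie_bracket (X 4) (X 1) = l\<^sub>1 *\<^sub>R X 2 + l\<^sub>4 *\<^sub>R X 3"
    and b21: "lie_bracket (X 2) (X 1) = - l\<^sub>2 *\<^sub>R X 3 + l\<^sub>1 *\<^sub>R X 4"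
    and J: "almost_complex A J" "left_invariant_endo A mul J"
    and J1: "apply_endo J (X 1) = X 3" and J2: "apply_endo J (X 2) = X 4"
    and J3: "apply_endo J (X 3) = - X 1" and J4: "apply_endo J (X 4) = - X 2"
    and g: "pseudo_riemannian A g" "left_invariant_metric A mul g"
    and g_pos: "\<And>p. g p (X 1 p) (X 1 p) = 1" "\<And>p. g p (X 2 p) (X 2 p) = 1"
    and g_neg: "\<And>p. g p (X 3 p) (X 3 p) = - 1" "\<And>p. g p (X 4 p) (X 4 p) = - 1"
    and g_orth: "\<And>p i j. i \<noteq> j \<Longrightarrow> g p (X i p) (X j p) = 0"
    and g': "g' = (\<lambda>p u v. g p u (J p v))"
    and D: "levi_civita A g' D"
  shows "isotropic_kaehler_norden A J g' D \<longleftrightarrow> (\<forall>p. scalar_curvature A g' D p = 0)"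
proof -
  from lie have "smooth_atlas A" by (simp add: lie_group_def)
  moreover have "smooth_field A (X i)" for i
  proof -
    have "X i \<in> lie_algebra A mul"
      using basis span_base[of "X i" "range X"] by (auto simp: basis_family_def)
    then show ?thesis by (simp add: lie_algebra_def)
  qed
  ultimately interpret norden_frame A g X J
    using J g J1 J2 J3 J4 g_pos g_neg g_orth by unfold_locales
  \<comment> \<open>Here the metric changes from \<open>g\<close> to the twin metric.
    \<open>basis_frame\<close> and \<open>smooth_expand\<close> were obtained from \<open>g\<close>,
    but their statements involve no metric.\<close>
  interpret twin_connection A g' D X J l\<^sub>1 l\<^sub>2 l\<^sub>3 l\<^sub>4
    using twin_pseudo_riemannian D basis_frame smooth_expand J(1) J_lincomb twin_lincomb
      b13 b24 b23 b34 b41 b21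
    unfolding g' by unfold_locales
  have "norden_metric A J g'" using twin_norden unfolding g' .
  \<comment> \<open>The other two clauses of the definition are established; what remains compares
    two constants that do not depend on \<open>p\<close>.\<close>
  then show ?thesis
    using D by (simp add: isotropic_kaehler_norden_def square_norm_deriv_eq scalar_curvature_eq)
qed

end
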